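(* Let $m\ge2$ and $n\ge1$. Then $$0\le\operatorname{Vol}(\mathcal{P}_{m,n}\cap \mathcal{D}_{m,n})-\operatorname{Vol}(\mathcal{H}_{m,n})\le ((m-1)!)^{-n}\,e^{-n\,m^{2-m}} .$$ Moreover, if $n>11$, then $$1-\frac{\operatorname{Vol}(\mathcal{H}_{m,n})}{\operatorname{Vol}(\mathcal{P}_{m,n}\cap \mathcal{D}_{m,n})}\le\frac{\mu(\varepsilon_1+\dots+\varepsilon_m>1)}{1-12/(n+1)}\,,$$ where $\mu$ is the probability measure on $[0,1]^m$ under which the coordinates $\varepsilon_1,\dots,\varepsilon_m$ are independent, each with density (on $[0,1]$) proportional to $(1-\varepsilon^{m-1})^n$.
   Context: For integers $m\ge2$, $n\ge1$, let $\mathcal{P}_{m,n}$ be the set of $(x,y)\in\mathbb{R}^{m\times n}\times\mathbb{R}^m$ with $0\le x_{ij}\le y_i$ for all $1\le i\le m$, $1\le j\le n$, and $y_i\le 1$ for all $i$. Let $\mathcal{D}_{m,n}=\{(x,y)\in\mathbb{R}^{m\times n}\times\mathbb{R}^m:\ \sum_{i=1}^m x_{ij}=1\ \text{for all } 1\le j\le n\}$, an affine subspace of dimension $d=(m-1)n+m$. The integer hull is $\mathcal{H}_{m,n}:=\operatorname{conv}\{(x,y)\in \mathcal{P}_{m,n}\cap \mathcal{D}_{m,n}:\ y\in\{0,1\}^m\}$. For $K\subset\mathcal{D}_{m,n}$, $\operatorname{Vol}(K)$ denotes the $d$-dimensional Lebesgue measure of the image of $K$ under the coordinate projection $\mathcal{D}_{m,n}\to\mathbb{R}^d$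 that deletes the variables $x_{mj}$, $1\le j\le n$ (an affine bijection). *)

theory Defs
  imports "HOL-Probability.Probability"
begin

text \<open>
  Points are pairs \<open>(x, y)\<close> with \<open>x\<close> an \<open>m \<times> n\<close> matrix, \<open>x $ i $ j\<close> being the entry in row \<open>i\<close>
  and column \<open>j\<close>, and \<open>y\<close> a vector of length \<open>m\<close>, where \<open>m = CARD('m)\<close> and \<open>n = CARD('n)\<close>.
\<close>

type_synonym ('m, 'n) point = "((real, 'n) vec, 'm) vec \<times> (real, 'm) vec"

definition P_set :: "('m::finite, 'n::finite) point set" where
  "P_set = {(x, y). (\<forall>i j. 0 \<le> x $ i $ j \<and> x $ i $ j \<le> y $ i) \<and> (\<forall>i. y $ i \<le> 1)}"

definition D_set :: "('m::finite, 'n::finite) point set" where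
  "D_set = {(x, y). \<forall>j. (\<Sum>i\<in>UNIV. x $ i $ j) = 1}"

definition integer_hull :: "('m::finite, 'n::finite) point set" where
  "integer_hull = convex hull {(x, y). (x, y) \<in> P_set \<inter> D_set \<and> (\<forall>i. y $ i \<in> {0, 1})}"

text \<open>
  To delete the last row of \<open>x\<close> inside the type system, the row index type is taken to be
  \<open>'k option\<close>: \<open>None\<close> is the last index \<open>m\<close> and the \<open>Some i\<close> are the other \<open>m - 1\<close> indices. Every
  \<open>m \<ge> 2\<close> arises as \<open>CARD('k option) = CARD('k) + 1\<close>, and the target of the projection is a
  Euclidean space of dimension \<open>(m - 1) * n + m\<close>.
\<close>

definition delete_last_row ::
  "('k::finite option, 'n::finite) point \<Rightarrow> (real^'n^'k) \<times> (real^('k option))" where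
  "delete_last_row = (\<lambda>(x, y). (\<chi> i. x $ Some i, y))"

definition Vol :: "('k::finite option, 'n::finite) point set \<Rightarrow> real" where
  "Vol K = measure lebesgue (delete_last_row ` K)"

definition eps_law :: "nat \<Rightarrow> nat \<Rightarrow> real measure" where
  "eps_law m n = density lborel
     (\<lambda>e. ennreal (indicator {0..1} e * (1 - e ^ (m - 1)) ^ n
                    / (LINT t:{0..1}|lborel. (1 - t ^ (m - 1)) ^ n)))"

definition mu :: "nat \<Rightarrow> nat \<Rightarrow> (nat \<Rightarrow> real) measure" where
  "mu m n = (\<Pi>\<^sub>M i\<in>{1..m}. eps_law m n)"

end

theory Submission imports Defs
begin

text \<open>
  Put \<open>\<epsilon>\<^sub>i = 1 - y\<^sub>i\<close> and \<open>p = m - 1\<close>. If \<open>\<Sum>i. \<epsilon>\<^sub>i \<le> 1\<close>, then \<open>y\<close> is the convex combination of the all-ones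
  vector and the vectors \<open>1 - e\<^sub>i\<close> with weights \<open>\<epsilon>\<^sub>i\<close>, and every column of \<open>x\<close> can be split accordingly:
  this is a transport problem with forbidden diagonal. So the two polytopes differ only above
  \<open>\<Sum>i. \<epsilon>\<^sub>i > 1\<close>.

  Above a fixed \<open>y\<close> the columns of \<open>x\<close> range independently over a truncated simplex. If \<open>A\<close> is the
  simplex with some corners cut off, shrinking \<open>A\<close> by the factor \<open>\<epsilon>\<^sub>i\<close> towards the vertex \<open>i\<close> maps
  it into the part of \<open>A\<close> that the \<open>i\<close>-th cut removes. Hence the relative volume of the truncated simplex is
  at most \<open>\<Prod>i. 1 - \<epsilon>\<^sub>i ^ p\<close>, while by the union bound it is at least \<open>1 - (\<Sum>i. \<epsilon>\<^sub>i ^ p)\<close>.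

  With Bernoulli's inequality \<open>\<Sum>i. \<epsilon>\<^sub>i ^ p \<ge> m powi (1 - p)\<close>, the product bound gives the first estimate. For the
  second one, Bonferroni's inequality compares the powers of the two bounds, and the resulting
  one-dimensional integrals are evaluated by a single integration by parts.
\<close>

section \<open>Simplices with truncated corners\<close>

text \<open>Barycentric coordinates for the standard simplex, \<open>None\<close> belonging to the
  vertex at the origin. For a column of a point of \<open>D_set\<close> with its last entry deleted,
  the \<open>None\<close> coordinate is that entry.\<close>

definition bary :: "real^'k \<Rightarrow> 'k option \<Rightarrow> real" where
  "bary x i = (case i of None \<Rightarrow> 1 - (\<Sum>k\<in>UNIV. x $ k) | Some k \<Rightarrow> x $ k)"

definition vert :: "'k option \<Rightarrow> real^'k" where
  "vert i = (case i of None \<Rightarrow> 0 | Some k \<Rightarrow> axis k 1)"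

text \<open>With \<open>e i = 1 - y $ i\<close> and \<open>A = UNIV\<close> these are the admissible
  columns above \<open>y\<close>. The set \<open>A\<close> of active cuts is a parameter so that the
  cuts can be added one at a time.\<close>

definition slice :: "('k option \<Rightarrow> real) \<Rightarrow> 'k option set \<Rightarrow> (real^'k) set" where
  "slice e A = {x. \<forall>i. 0 \<le> bary x i \<and> (i \<in> A \<longrightarrow> bary x i \<le> 1 - e i)}"

lemma sum_option: "(\<Sum>i\<in>(UNIV::'k::finite option set). f i) = f None + (\<Sum>k\<in>UNIV. f (Some k) :: real)"
  by (simp add: UNIV_option_conv sum.reindex)

lemma sum_bary: "(\<Sum>i\<in>UNIV. bary x i) = 1"
  by (simp add: sum_option bary_def)

text \<open>Barycentric coordinates are affine, and those of \<open>vert i\<close> are the indicator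
  of \<open>i\<close>. The factor \<open>s\<close> is arbitrary, so the formula also covers the
  inverse of a contraction.\<close>

lemma bary_dilate:
  fixes x :: "real^'k::finite"
  shows "bary (s *\<^sub>R x + (1 - s) *\<^sub>R vert i) k = s * bary x k + (1 - s) * (if k = i then 1 else 0)"
  by (cases i; cases k)
     (auto simp: bary_def vert_def axis_def sum.distrib simp flip: sum_distrib_left, auto simp: algebra_simps)

lemma continuous_bary: "continuous_on UNIV (\<lambda>x::real^'k::finite. bary x i)"
  by (cases i) (auto simp: bary_def intro!: continuous_intros)

lemma closed_slice: "closed (slice e A :: (real^'k::finite) set)"
proof -
  have "slice e A = (\<Inter>i. {x::real^'k. 0 \<le> bary x i}) \<inter> (\<Inter>i\<in>A. {x. bary x i \<le> 1 - e i})"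
    by (auto simp: slice_def)
  also have "closed \<dots>"
    by (intro closed_Int closed_INT ballI closed_Collect_le continuous_bary continuous_on_const)
  finally show ?thesis .
qed

lemma slice_antimono: "A \<subseteq> B \<Longrightarrow> slice e B \<subseteq> slice e A"
  by (auto simp: slice_def)

lemma slice_empty: "slice e {} = convex hull (insert 0 (Basis :: (real^'k::finite) set))"
proof -
  have "(Basis :: (real^'k) set) = (\<lambda>k. axis k 1) ` UNIV"
    by (auto simp: Basis_vec_def)
  then have "(\<Sum>b\<in>Basis. x \<bullet> b) = (\<Sum>k\<in>UNIV. x $ k)" for x :: "real^'k"
    unfolding \<open>Basis = _\<close> by (subst sum.reindex) (auto simp: inj_on_def axis_eq_axis inner_axis)
  then show ?thesis
    unfolding std_simplex slice_def
    by (auto simp: bary_def Basis_vec_def inner_axis split: option.splits)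
qed


lemma bounded_slice: "bounded (slice e A :: (real^'k::finite) set)"
  by (rule bounded_subset[OF _ slice_antimono[OF empty_subsetI]])
    (simp add: slice_empty bounded_convex_hull finite_imp_bounded)

lemma lmeasurable_slice: "(slice e A :: (real^'k::finite) set) \<in> lmeasurable"
  by (intro lmeasurable_compact) (simp add: compact_eq_bounded_closed bounded_slice closed_slice)

lemma measure_slice_empty:
  "measure lebesgue (slice e {} :: (real^'k::finite) set) = 1 / fact CARD('k)"
  using content_std_simplex[where 'a="real^'k"] closed_slice[of "e" "{}"]
  by (simp add: slice_empty measure_completion borel_closed)

text \<open>Shrinking by \<open>s\<close> towards \<open>vert i\<close> scales volumes by the power
  \<open>CARD('k)\<close> of \<open>s\<close>. It decreases every coordinate other than
  \<open>i\<close>, hence respects the cuts in \<open>A\<close>, and it raises coordinate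
  \<open>i\<close> to at least \<open>1 - s\<close>. For \<open>s < e i\<close> this violates the
  new cut, so the copy and the newly cut slice are disjoint inside the old slice.\<close>

lemma measure_slice_insert_le:
  fixes e :: "'k::finite option \<Rightarrow> real"
  assumes i: "i \<notin> A" and e: "\<And>k. 0 \<le> e k" and e1: "\<And>k. e k \<le> 1"
  shows "measure lebesgue (slice e (insert i A))
           \<le> (1 - e i ^ CARD('k)) * measure lebesgue (slice e A)"
proof -
  let ?V = "measure lebesgue :: (real^'k) set \<Rightarrow> real"
  \<comment> \<open>For \<open>s < e i\<close> the shrunken copy is disjoint from the slice; the claim is the limit \<open>s \<rightarrow> e i\<close>.\<close>
  have *: "?V (slice e (insert i A)) \<le> (1 - s ^ CARD('k)) * ?V (slice e A)"
    if s: "s \<in> {0<..<e i}" "s \<le> 1" for s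
  proof -
    let ?\<phi> = "\<lambda>x. s *\<^sub>R x + (1 - s) *\<^sub>R vert i"
    have meas: "?\<phi> ` slice e A \<in> lmeasurable"
      by (intro lmeasurable_compact compact_continuous_image continuous_intros)
        (simp add: compact_eq_bounded_closed bounded_slice closed_slice)
    have sub: "?\<phi> ` slice e A \<subseteq> slice e A"
    proof (clarsimp simp: slice_def bary_dilate i)
      fix x k
      assume x: "\<forall>i. 0 \<le> bary x i \<and> (i \<in> A \<longrightarrow> bary x i \<le> 1 - e i)"
      have "s * bary x k \<le> bary x k"
        using x s by (intro mult_left_le_one_le) auto
      then show "(k = i \<longrightarrow> 0 \<le> s * bary x i + (1 - s)) \<and>
        (k \<noteq> i \<longrightarrow> 0 \<le> s * bary x k \<and> (k \<in> A \<longrightarrow> s * bary x k \<le> 1 - e k))"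
        using x s by (auto intro: order.trans)
    qed
    have disj: "?\<phi> ` slice e A \<inter> slice e (insert i A) = {}"
    proof -
      have False if x: "x \<in> slice e A" and y: "?\<phi> x \<in> slice e (insert i A)" for x
      proof -
        have "bary (?\<phi> x) i \<le> 1 - e i" using y by (auto simp: slice_def)
        moreover have "0 \<le> s * bary x i" using x s by (auto simp: slice_def)
        ultimately show False using s by (simp add: bary_dilate)
      qed
      then show ?thesis by blast
    qed
    have "?V (?\<phi> ` slice e A) + ?V (slice e (insert i A))
            = ?V (?\<phi> ` slice e A \<union> slice e (insert i A))"
      using measure_Un3[OF meas lmeasurable_slice[of e "insert i A"]] disj by simp
    also have "\<dots> \<le> ?V (slice e A)"
      using sub slice_antimono[of A "insert i A" e]
      by (intro measure_mono_fmeasurable)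
         (use meas lmeasurable_slice in \<open>auto intro!: fmeasurableD fmeasurable.Un\<close>)
    finally show ?thesis
      using s by (simp add: measure_lebesgue_affine) (simp add: algebra_simps)
  qed
  show ?thesis
  \<comment> \<open>If \<open>e i = 0\<close>, the interval for \<open>s\<close> is empty and the
    claim reduces to monotonicity.\<close>
  proof (cases "e i = 0")
    case True
    then show ?thesis
      using measure_mono_fmeasurable[OF slice_antimono[of A "insert i A" e] _ lmeasurable_slice]
      by (auto simp: fmeasurableD lmeasurable_slice power_0_left)
  next
    case False
    have lim: "((\<lambda>s. (1 - s ^ CARD('k)) * ?V (slice e A)) \<longlongrightarrow> (1 - e i ^ CARD('k)) * ?V (slice e A))
        (at_left (e i))"
      by (intro tendsto_intros)
    have "\<forall>\<^sub>F s in at_left (e i). s \<in> {0<..<e i}"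
      using False e[of i] by (intro eventually_at_left_real) auto
    then have "\<forall>\<^sub>F s in at_left (e i). ?V (slice e (insert i A)) \<le> (1 - s ^ CARD('k)) * ?V (slice e A)"
      by (rule eventually_mono) (use *  e1[of i] in auto)
    then show ?thesis
      using tendsto_lowerbound[OF lim] by simp
  qed
qed

lemma measure_slice_le:
  fixes e :: "'k::finite option \<Rightarrow> real"
  assumes e: "\<And>k. 0 \<le> e k" "\<And>k. e k \<le> 1"
  shows "measure lebesgue (slice e A) \<le> (\<Prod>i\<in>A. 1 - e i ^ CARD('k)) / fact CARD('k)"
  using finite[of A]
proof (induction A rule: finite_induct)
  case empty
  then show ?case by (simp add: measure_slice_empty)
next
  case (insert i A)
  have "measure lebesgue (slice e (insert i A))
      \<le> (1 - e i ^ CARD('k)) * measure lebesgue (slice e A)"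
    by (rule measure_slice_insert_le) (use insert e in auto)
  also have "\<dots> \<le> (1 - e i ^ CARD('k)) * ((\<Prod>i\<in>A. 1 - e i ^ CARD('k)) / fact CARD('k))"
    using insert e by (intro mult_left_mono) (auto simp: power_le_one)
  finally show ?case using insert by simp
qed

text \<open>Here the full simplex is scaled: the corner that the cut \<open>i\<close> removes lies
  in the copy scaled by \<open>e i\<close> towards \<open>vert i\<close>. Subtracting the volumes of
  all these copies is the union bound.\<close>

lemma measure_slice_ge:
  fixes e :: "'k::finite option \<Rightarrow> real"
  assumes e: "\<And>k. 0 \<le> e k"
  shows "(1 - (\<Sum>i\<in>UNIV. e i ^ CARD('k))) / fact CARD('k) \<le> measure lebesgue (slice e UNIV)"
proof -
  let ?V = "measure lebesgue :: (real^'k) set \<Rightarrow> real"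
  let ?c = "1 / fact CARD('k) :: real"
  let ?\<phi> = "\<lambda>i x. e i *\<^sub>R x + (1 - e i) *\<^sub>R vert i"
  let ?S = "slice e {}"
  have meas: "?\<phi> i ` ?S \<in> lmeasurable" for i
    by (intro lmeasurable_compact compact_continuous_image continuous_intros)
      (simp add: compact_eq_bounded_closed bounded_slice closed_slice)
  have "x \<in> slice e UNIV \<union> (\<Union>i. ?\<phi> i ` ?S)" if x: "x \<in> ?S" for x
  proof (cases "x \<in> slice e UNIV")
    case False
    then obtain i where i: "bary x i > 1 - e i"
      using x by (simp add: slice_def) (meson not_le)
    have "bary x i \<le> (\<Sum>i\<in>UNIV. bary x i)"
      using x by (intro member_le_sum) (auto simp: slice_def)
    with i have pos: "e i > 0" by (simp add: sum_bary)
    \<comment> \<open>The preimage of \<open>x\<close> under the scaling. Its coordinate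
      \<open>i\<close> is nonnegative precisely because \<open>x\<close> violates the cut
      \<open>i\<close>.\<close>
    define z where "z = (1 / e i) *\<^sub>R x + (1 - 1 / e i) *\<^sub>R vert i"
    have "bary z k \<ge> 0" for k
      using x i pos unfolding z_def bary_dilate by (auto simp: slice_def field_simps)
    moreover have "?\<phi> i z = x"
    proof -
      have "?\<phi> i z = (e i * (1 / e i)) *\<^sub>R x + (e i * (1 - 1 / e i) + (1 - e i)) *\<^sub>R vert i"
        by (simp only: z_def scaleR_right_distrib scaleR_left_distrib scaleR_scaleR add.assoc)
      also have "e i * (1 - 1 / e i) + (1 - e i) = 0" using pos by (simp add: field_simps)
      finally show ?thesis using pos by simp
    qed
    ultimately show ?thesis
      by (auto simp: slice_def image_iff intro!: exI[of _ i] bexI[of _ z])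
  qed auto
  then have "?V ?S \<le> ?V (slice e UNIV \<union> (\<Union>i. ?\<phi> i ` ?S))"
    by (intro measure_mono_fmeasurable fmeasurable.Un fmeasurable.finite_UN)
      (use meas lmeasurable_slice in \<open>auto intro!: fmeasurableD\<close>)
  also have "\<dots> \<le> ?V (slice e UNIV) + ?V (\<Union>i. ?\<phi> i ` ?S)"
    by (intro measure_Un_le sets.finite_UN) (use meas lmeasurable_slice in \<open>auto intro!: fmeasurableD\<close>)
  also have "?V (\<Union>i. ?\<phi> i ` ?S) \<le> (\<Sum>i\<in>UNIV. ?V (?\<phi> i ` ?S))"
    by (intro measure_UNION_le) (use meas in \<open>auto intro!: fmeasurableD\<close>)
  also have "\<dots> = (\<Sum>i\<in>UNIV. e i ^ CARD('k) * ?c)"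
    using e by (simp add: measure_lebesgue_affine measure_slice_empty)
  finally show ?thesis
    by (simp add: measure_slice_empty diff_divide_distrib sum_divide_distrib)
qed

section \<open>Membership in the integer hull\<close>

text \<open>Count the positive terms. A single one is at most \<open>d\<close> by the last
  hypothesis. If there are at least two, the sum is at most
  \<open>s + (s - d) - 2 * (s - d) = d\<close>. This is what makes the lower bounds \<open>l\<close>
  in \<open>transport\<close> affordable.\<close>

lemma sum_pos_part_le:
  fixes a x e :: "'a \<Rightarrow> real"
  assumes I: "finite I" and x: "\<And>k. k \<in> I \<Longrightarrow> 0 \<le> x k" and e: "\<And>k. k \<in> I \<Longrightarrow> 0 \<le> e k"
    and d: "0 \<le> d" "d \<le> s" and "sum x I \<le> s" and "sum e I \<le> s - d"
    and "\<And>k. k \<in> I \<Longrightarrow> x k + e k \<le> s"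
  shows "(\<Sum>k\<in>I. max 0 (x k + e k + d - s)) \<le> d"
proof -
  define K where "K = {k\<in>I. 0 < x k + e k + d - s}"
  have [simp]: "finite K" using I by (simp add: K_def)
  have "(\<Sum>k\<in>I. max 0 (x k + e k + d - s)) = (\<Sum>k\<in>K. x k + e k + d - s)"
    using I by (intro sum.mono_neutral_cong_right) (auto simp: K_def)
  also have "\<dots> = sum x K + sum e K - real (card K) * (s - d)"
    by (simp add: sum.distrib sum_subtractf algebra_simps)
  also have "\<dots> \<le> d"
  proof -
    consider "K = {}" | k where "K = {k}" | "2 \<le> card K"
      by (metis \<open>finite K\<close> card_0_eq card_1_singletonE less_2_cases_iff not_less One_nat_def)
    then show ?thesis
    proof cases
      case 2
      then have "k \<in> I" by (auto simp: K_def)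
      with 2 assms(8) show ?thesis by (simp add: algebra_simps)
    next
      case 3
      have "sum x K \<le> s"
        using sum_mono2[of I K x] I x assms(6) by (force simp: K_def)
      moreover have "sum e K \<le> s - d"
        using sum_mono2[of I K e] I e assms(7) by (force simp: K_def)
      moreover have "2 * (s - d) \<le> real (card K) * (s - d)"
        using 3 d by (intro mult_right_mono) auto
      ultimately show ?thesis by simp
    qed (use d in auto)
  qed
  finally show ?thesis .
qed

text \<open>Source \<open>i\<close> has supply \<open>e i\<close>, sink \<open>k\<close> has
  capacity \<open>x k\<close>, and \<open>i\<close> must not ship to itself. The last two hypotheses
  are the cut conditions: two distinct sources together reach every sink, so only the whole of
  \<open>I\<close> and single sources impose a constraint. Sources are served one after the
  other.\<close>

lemma transport:
  fixes x e :: "'a::finite \<Rightarrow> real"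
  assumes "\<And>k. 0 \<le> x k" and "\<And>i. i \<in> I \<Longrightarrow> 0 \<le> e i"
    and "sum e I \<le> sum x UNIV" and "\<And>i. i \<in> I \<Longrightarrow> x i + e i \<le> sum x UNIV"
  shows "\<exists>T. (\<forall>i k. 0 \<le> T i k) \<and> (\<forall>i\<in>I. T i i = 0 \<and> (\<Sum>k\<in>UNIV. T i k) = e i)
           \<and> (\<forall>k. (\<Sum>i\<in>I. T i k) \<le> x k)"
  using finite[of I] assms
proof (induction I arbitrary: x rule: finite_induct)
  case empty
  then show ?case by (intro exI[of _ "\<lambda>_ _. 0"]) auto
next
  case (insert i I)
  define s where "s = sum x UNIV"
  \<comment> \<open>Serving the source \<open>i\<close> first, \<open>l\<close> is what it must send for the hypotheses to survive for the
    remaining sources, and \<open>u\<close> is what it may send.\<close>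
  define l where "l k = (if k \<in> I then max 0 (x k + e k + e i - s) else 0)" for k
  define u where "u k = (if k = i then 0 else x k)" for k
  have ei: "0 \<le> e i" "sum e I \<le> s - e i" "x i \<le> s - e i"
    using insert.prems insert.hyps by (auto simp: s_def algebra_simps)
  \<comment> \<open>For \<open>k\<close> in \<open>I\<close> this says that the two supplies
    \<open>e k\<close> and \<open>e i\<close> fit together into the total capacity
    \<open>s\<close>.\<close>
  have lu: "l k \<le> u k" "0 \<le> l k" for k
  proof -
    have "e k + e i \<le> s" if "k \<in> I"
      using member_le_sum[of k I e] that ei insert.prems(2) by auto
    then show "l k \<le> u k" "0 \<le> l k"
      using insert.prems(1)[of k] insert.hyps by (auto simp: l_def u_def)
  qed
  have su: "sum u UNIV = s - x i"
  proof -
    have "sum u UNIV = sum x (UNIV - {i})"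
      unfolding u_def by (intro sum.mono_neutral_cong_right) auto
    then show ?thesis by (simp add: s_def sum_diff1)
  qed
  have sl: "sum l UNIV \<le> e i"
  proof -
    have "sum l UNIV = (\<Sum>k\<in>I. max 0 (x k + e k + e i - s))"
      unfolding l_def by (intro sum.mono_neutral_cong_right) auto
    also have "\<dots> \<le> e i"
    proof (rule sum_pos_part_le)
      show "sum x I \<le> s" unfolding s_def using insert.prems(1) by (intro sum_mono2) auto
      show "e i \<le> s" using ei insert.prems(1)[of i] by linarith
    qed (use insert.prems ei in \<open>auto simp: s_def\<close>)
    finally show ?thesis .
  qed
  \<comment> \<open>Since \<open>sum l UNIV \<le> e i \<le> sum u UNIV\<close>, a point on the
    segment from \<open>l\<close> to \<open>u\<close> has the sum \<open>e i\<close>. If both sums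
    agree, \<open>l\<close> itself serves and no quotient is formed.\<close>
  obtain z where z: "\<And>k. l k \<le> z k" "\<And>k. z k \<le> u k" "sum z UNIV = e i"
  proof (cases "sum u UNIV = sum l UNIV")
    case True
    then show ?thesis using that[of l] sl su ei lu by fastforce
  next
    case False
    then have pos: "sum u UNIV - sum l UNIV > 0"
      using sum_mono[of UNIV l u] lu by force
    define t where "t = (e i - sum l UNIV) / (sum u UNIV - sum l UNIV)"
    have t: "0 \<le> t" "t \<le> 1" using pos sl su ei by (auto simp: t_def field_simps)
    show ?thesis
    proof (rule that[of "\<lambda>k. l k + t * (u k - l k)"])
      show "l k \<le> l k + t * (u k - l k)" for k using t lu[of k] by simp
      show "l k + t * (u k - l k) \<le> u k" for k
        using mult_right_mono[of t 1 "u k - l k"] t lu[of k] by simp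
      have "(\<Sum>k\<in>UNIV. l k + t * (u k - l k)) = sum l UNIV + t * (sum u UNIV - sum l UNIV)"
        by (simp add: sum.distrib sum_subtractf flip: sum_distrib_left)
      then show "(\<Sum>k\<in>UNIV. l k + t * (u k - l k)) = e i"
        using pos by (simp add: t_def)
    qed
  qed
  have z0: "0 \<le> z k" for k using lu(2)[of k] z(1)[of k] by simp
  have zi: "z i = 0" using z0[of i] z(2)[of i] by (simp add: u_def)
  have zx: "z k \<le> x k" for k using z(2)[of k] insert.prems(1)[of k] by (auto simp: u_def split: if_splits)
  have sz: "(\<Sum>k\<in>UNIV. x k - z k) = s - e i" by (simp add: sum_subtractf z s_def)
  have "\<exists>T. (\<forall>i k. 0 \<le> T i k) \<and> (\<forall>i\<in>I. T i i = 0 \<and> (\<Sum>k\<in>UNIV. T i k) = e i)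
           \<and> (\<forall>k. (\<Sum>i\<in>I. T i k) \<le> x k - z k)"
  proof (rule insert.IH)
    fix k assume "k \<in> I"
    with z(1)[of k] show "x k - z k + e k \<le> (\<Sum>k\<in>UNIV. x k - z k)"
      by (simp add: sz l_def)
  qed (use zx insert.prems ei sz in auto)
  then obtain T where T: "\<And>i k. 0 \<le> T i k" "\<And>i. i \<in> I \<Longrightarrow> T i i = 0 \<and> (\<Sum>k\<in>UNIV. T i k) = e i"
     "\<And>k. (\<Sum>i\<in>I. T i k) \<le> x k - z k" by blast
  have "(\<Sum>j\<in>I. (T(i := z)) j k) = (\<Sum>j\<in>I. T j k)" for k
    using insert.hyps by (intro sum.cong) auto
  then show ?case
    using T z0 zi z(3) insert.hyps
    by (intro exI[of _ "T(i := z)"]) (fastforce simp: algebra_simps)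
qed

text \<open>In each column \<open>j\<close> the supplies are \<open>1 - y $ i\<close> and the
  capacities are the entries of \<open>x\<close>. The cut conditions of \<open>transport\<close>
  become the assumption on the sum and \<open>x $ i $ j \<le> y $ i\<close>. The forbidden diagonal
  gives a zero in row \<open>i\<close> at the vertex whose \<open>y\<close> vanishes at
  \<open>i\<close>.\<close>

lemma mem_integer_hull:
  fixes x :: "real^'n::finite^'m::finite"
  assumes xy: "(x, y) \<in> P_set \<inter> D_set" and e: "(\<Sum>i\<in>UNIV. 1 - y $ i) \<le> 1"
  shows "(x, y) \<in> integer_hull"
proof -
  have x0: "0 \<le> x $ i $ j" and xle: "x $ i $ j \<le> y $ i" and y1: "y $ i \<le> 1"
    and xs: "(\<Sum>i\<in>UNIV. x $ i $ j) = 1" for i j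
    using xy by (auto simp: P_set_def D_set_def)
  have "\<exists>T. (\<forall>i k. 0 \<le> T i k) \<and> (\<forall>i\<in>UNIV. T i i = 0 \<and> (\<Sum>k\<in>UNIV. T i k) = 1 - y $ i)
           \<and> (\<forall>k. (\<Sum>i\<in>UNIV. T i k) \<le> x $ k $ j)" for j
    by (rule transport) (use x0 xle y1 xs e in auto)
  then obtain T where T: "\<And>j i k. 0 \<le> T j i k" "\<And>j i. T j i i = 0"
    "\<And>j i. (\<Sum>k\<in>UNIV. T j i k) = 1 - y $ i" "\<And>j k. (\<Sum>i\<in>UNIV. T j i k) \<le> x $ k $ j"
    by (metis UNIV_I)
  \<comment> \<open>\<open>U j q'\<close> is the share of column \<open>j\<close> given to the
    vertex \<open>q'\<close>: the transported amounts for \<open>Some i\<close>, the remainder for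
    the all-ones vector \<open>None\<close>. Each share sums to the weight \<open>w q'\<close>, so
    dividing by it restores the column sum 1.\<close>
  define U where "U j q' k = (case q' of None \<Rightarrow> x $ k $ j - (\<Sum>i\<in>UNIV. T j i k) | Some i \<Rightarrow> T j i k)" for j q' k
  define w where "w q' = (case q' of None \<Rightarrow> 1 - (\<Sum>i\<in>UNIV. 1 - y $ i) | Some i \<Rightarrow> 1 - y $ i)" for q'
  define q :: "'m option \<Rightarrow> (real^'n^'m) \<times> (real^'m)" where
    "q q' = ((\<chi> k j. U j q' k / w q'), (\<chi> k. if q' = Some k then 0 else 1))" for q'
  have U0: "0 \<le> U j q' k" for j q' k using T by (auto simp: U_def split: option.splits)
  have w0: "0 \<le> w q'" for q' using e y1 by (auto simp: w_def split: option.splits)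
  have Uii: "U j (Some i) i = 0" for j i by (simp add: U_def T)
  have Usum: "(\<Sum>k\<in>UNIV. U j q' k) = w q'" for j q'
  proof (cases q')
    case None
    have "(\<Sum>k\<in>UNIV. \<Sum>i\<in>UNIV. T j i k) = (\<Sum>i\<in>UNIV. 1 - y $ i)"
      by (subst sum.swap) (simp add: T)
    then show ?thesis using None xs by (simp add: U_def w_def sum_subtractf)
  qed (simp add: U_def w_def T)
  \<comment> \<open>If \<open>w q' = 0\<close>, division by zero makes the matrix of
    \<open>q q'\<close> zero, which lies outside \<open>D_set\<close>. Such vertices must be left
    out of the combination.\<close>
  define S where "S = {q'. w q' > 0}"
  have "(\<Sum>q'\<in>S. w q' *\<^sub>R q q') \<in> integer_hull"
    unfolding integer_hull_def
  proof (rule convex_sum)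
    have "sum w S = sum w UNIV"
      using w0 by (intro sum.mono_neutral_left) (auto simp: S_def not_less intro: antisym)
    also have "\<dots> = 1" by (simp add: sum_option w_def)
    finally show "sum w S = 1" .
    fix q' assume q': "q' \<in> S"
    have le: "U j q' k \<le> w q'" for j k
      unfolding Usum[of j, symmetric] by (rule member_le_sum) (auto simp: U0)
    have "q q' \<in> {(x, y). (x, y) \<in> P_set \<inter> D_set \<and> (\<forall>i. y $ i \<in> {0, 1})}"
      using q' U0 le Uii by (auto simp: q_def P_set_def D_set_def S_def divide_simps Usum
          simp flip: sum_divide_distrib)
    then show "q q' \<in> convex hull {(x, y). (x, y) \<in> P_set \<inter> D_set \<and> (\<forall>i. y $ i \<in> {0, 1})}"
      by (rule hull_inc)
  qed (auto simp: w0)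
  also have "(\<Sum>q'\<in>S. w q' *\<^sub>R q q') = (x, y)"
  proof (rule prod_eqI)
    have "U j q' k = 0" if "q' \<notin> S" for j q' k
      using that w0[of q'] Usum[of j q'] U0 by (auto simp: S_def sum_nonneg_eq_0_iff)
    then have "(\<Sum>q'\<in>S. w q' * (U j q' k / w q')) = (\<Sum>q'\<in>UNIV. U j q' k)" for j k
      by (intro sum.mono_neutral_cong_left) (auto simp: S_def)
    then show "fst (\<Sum>q'\<in>S. w q' *\<^sub>R q q') = fst (x, y)"
      by (simp add: fst_sum q_def vec_eq_iff sum_option U_def)
    have "(\<Sum>q'\<in>S. w q' * (if q' = Some k then 0 else 1)) = (\<Sum>q'\<in>UNIV. w q' * (if q' = Some k then 0 else 1))" for k
      using w0 by (intro sum.mono_neutral_left) (auto simp: S_def not_less intro: antisym)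
    also have "(\<Sum>q'\<in>UNIV. w q' * (if q' = Some k then 0 else 1)) = (\<Sum>q'\<in>UNIV. w q') - w (Some k)" for k
      by (simp add: if_distrib[of "\<lambda>z. _ * z"] sum.If_cases sum_diff1 Compl_eq_Diff_UNIV cong: if_cong)
    finally show "snd (\<Sum>q'\<in>S. w q' *\<^sub>R q q') = snd (x, y)"
      by (simp add: snd_sum q_def vec_eq_iff sum_option w_def)
  qed
  finally show ?thesis .
qed

section \<open>Integration over the fibres\<close>

lemma Basis_vec_real: "(Basis :: (real^'k::finite) set) = range (\<lambda>k. axis k 1)"
  by (auto simp: Basis_vec_def)

lemma prod_Basis_vec: "(\<Prod>b\<in>(Basis :: (real^'k::finite) set). w \<bullet> b) = (\<Prod>i\<in>UNIV. w $ i)"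
  unfolding Basis_vec_real
  by (subst prod.reindex) (auto simp: inj_on_def axis_eq_axis inner_axis)

lemma prod_Basis_mat:
  "(\<Prod>b\<in>(Basis :: (real^'n::finite^'k::finite) set). w \<bullet> b) = (\<Prod>i\<in>UNIV. \<Prod>j\<in>UNIV. w $ i $ j)"
proof -
  let ?a = "\<lambda>(i :: 'k, j :: 'n). axis i (axis j (1::real))"
  have inj: "inj ?a"
    by (auto simp: inj_def axis_eq_axis)
  have Basis_eq: "(Basis :: (real^'n^'k) set) = range ?a"
    unfolding Basis_vec_def by (auto simp: image_def)
  have "(\<Prod>b\<in>(Basis :: (real^'n^'k) set). w \<bullet> b) = (\<Prod>q\<in>UNIV. w \<bullet> ?a q)"
    unfolding Basis_eq by (subst prod.reindex[OF inj]) (simp add: o_def)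
  also have "\<dots> = (\<Prod>q\<in>UNIV \<times> UNIV. case q of (i, j) \<Rightarrow> w $ i $ j)"
    by (intro prod.cong) (auto simp: inner_axis)
  finally show ?thesis
    by (simp add: prod.cartesian_product)
qed

lemma measurable_columns:
  "(\<lambda>f. \<chi> i j. f j $ i) \<in> PiM UNIV (\<lambda>_::'n. lborel :: (real^'k) measure)
     \<rightarrow>\<^sub>M (borel :: (real^'n::finite^'k::finite) measure)"
proof -
  have "(\<lambda>f. f j $ i) \<in> borel_measurable (PiM UNIV (\<lambda>_::'n. lborel :: (real^'k) measure))" for i j
  proof (rule measurable_compose[of "\<lambda>f. f j"])
    show "(\<lambda>f. f j) \<in> PiM UNIV (\<lambda>_::'n. lborel :: (real^'k) measure) \<rightarrow>\<^sub>M lborel"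
      by (rule measurable_component_singleton) simp
    show "(\<lambda>x :: real^'k. x $ i) \<in> borel_measurable lborel"
      by (simp add: borel_measurable_continuous_onI continuous_intros)
  qed
  then show ?thesis
    by (subst borel_measurable_euclidean_space) (auto simp: Basis_vec_def inner_axis)
qed

text \<open>Matrices are nested row by row, while the constraints decouple column by column. The two
  measures agree on boxes, since a box of matrices is a product of boxes of columns.\<close>

lemma lborel_columns:
  "(lborel :: (real^'n::finite^'k::finite) measure)
     = distr (PiM UNIV (\<lambda>_::'n. lborel :: (real^'k) measure)) borel (\<lambda>f. \<chi> i j. f j $ i)"
proof (rule lborel_eqI)
  interpret product_sigma_finite "\<lambda>_::'n. lborel :: (real^'k) measure" by standard
  let ?N = "PiM UNIV (\<lambda>_::'n. lborel :: (real^'k) measure)"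
  fix l u :: "real^'n^'k"
  assume le: "\<And>b. b \<in> Basis \<Longrightarrow> l \<bullet> b \<le> u \<bullet> b"
  have le': "l $ i $ j \<le> u $ i $ j" for i j
  proof -
    have "axis i (axis j 1) \<in> (Basis :: (real^'n^'k) set)" by (auto simp: Basis_vec_def)
    from le[OF this] show ?thesis by (simp add: inner_axis)
  qed
  have pre: "(\<lambda>f. \<chi> i j. f j $ i) -` box l u \<inter> space ?N
     = Pi\<^sub>E UNIV (\<lambda>j. box (\<chi> i. l $ i $ j) (\<chi> i. u $ i $ j))"
    by (auto simp: space_PiM mem_box Basis_vec_def inner_axis PiE_iff)
  have "emeasure (distr ?N borel (\<lambda>f. \<chi> i j. f j $ i)) (box l u)
     = emeasure ?N (Pi\<^sub>E UNIV (\<lambda>j. box (\<chi> i. l $ i $ j) (\<chi> i. u $ i $ j)))"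
    by (subst emeasure_distr[OF measurable_columns]) (simp_all add: pre)
  also have "\<dots> = (\<Prod>j\<in>UNIV. emeasure lborel (box (\<chi> i. l $ i $ j) (\<chi> i. u $ i $ j)))"
    by (rule emeasure_PiM) auto
  also have "\<dots> = (\<Prod>j\<in>UNIV. ennreal (\<Prod>i\<in>UNIV. u $ i $ j - l $ i $ j))"
  proof (intro prod.cong refl)
    fix j :: 'n
    have "emeasure lborel (box (\<chi> i. l $ i $ j) (\<chi> i. u $ i $ j))
        = (\<Prod>b\<in>Basis. ((\<chi> i. u $ i $ j) - (\<chi> i. l $ i $ j) :: real^'k) \<bullet> b)"
      by (rule emeasure_lborel_box) (auto simp: Basis_vec_def inner_axis le')
    then show "emeasure lborel (box (\<chi> i. l $ i $ j) (\<chi> i. u $ i $ j)) = ennreal (\<Prod>i\<in>UNIV. u $ i $ j - l $ i $ j)"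
      by (simp add: prod_Basis_vec)
  qed
  also have "\<dots> = ennreal (\<Prod>j\<in>UNIV. \<Prod>i\<in>UNIV. u $ i $ j - l $ i $ j)"
    by (rule prod_ennreal) (auto intro!: prod_nonneg simp: le')
  also have "(\<Prod>j\<in>UNIV. \<Prod>i\<in>UNIV. u $ i $ j - l $ i $ j) = (\<Prod>b\<in>Basis. (u - l) \<bullet> b)"
    unfolding prod_Basis_mat by (subst prod.swap) simp
  finally show "emeasure (distr ?N borel (\<lambda>f. \<chi> i j. f j $ i)) (box l u) = (\<Prod>b\<in>Basis. (u - l) \<bullet> b)" .
qed simp

lemma emeasure_columns:
  fixes S :: "(real^'k::finite) set"
  assumes [measurable]: "S \<in> sets borel"
  shows "emeasure lborel {x :: real^'n::finite^'k. \<forall>j. (\<chi> i. x $ i $ j) \<in> S} = emeasure lborel S ^ CARD('n)"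
proof -
  interpret product_sigma_finite "\<lambda>_::'n. lborel :: (real^'k) measure" by standard
  let ?N = "PiM UNIV (\<lambda>_::'n. lborel :: (real^'k) measure)"
  have "(\<lambda>x :: real^'n^'k. \<chi> i. x $ i $ j) \<in> borel \<rightarrow>\<^sub>M borel" for j
    by (intro borel_measurable_continuous_onI continuous_intros)
  then have "(\<Inter>j. (\<lambda>x :: real^'n^'k. \<chi> i. x $ i $ j) -` S \<inter> space borel) \<in> sets borel"
    by (intro sets.finite_INT measurable_sets[OF _ assms]) auto
  also have "(\<Inter>j. (\<lambda>x :: real^'n^'k. \<chi> i. x $ i $ j) -` S \<inter> space borel)
     = {x. \<forall>j. (\<chi> i. x $ i $ j) \<in> S}" by auto
  finally have m: "{x :: real^'n^'k. \<forall>j. (\<chi> i. x $ i $ j) \<in> S} \<in> sets borel" .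
  have pre: "(\<lambda>f. \<chi> i j. f j $ i) -` {x :: real^'n^'k. \<forall>j. (\<chi> i. x $ i $ j) \<in> S} \<inter> space ?N = Pi\<^sub>E UNIV (\<lambda>_. S)"
    by (auto simp: space_PiM PiE_iff)
  show ?thesis
    by (subst lborel_columns, subst emeasure_distr[OF measurable_columns m], subst pre, subst emeasure_PiM) auto
qed

lemma measurable_vec_reflect:
  fixes b :: "'m::finite \<Rightarrow> 'b"
  assumes b: "bij_betw b UNIV I"
  shows "(\<lambda>f. \<chi> i. 1 - f (b i)) \<in> PiM I (\<lambda>_. lborel) \<rightarrow>\<^sub>M (borel :: (real^'m) measure)"
proof -
  have "b i \<in> I" for i using bij_betwE[OF b] by simp
  then have "(\<lambda>f. f (b i)) \<in> PiM I (\<lambda>_. lborel :: real measure) \<rightarrow>\<^sub>M lborel" for i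
    by (rule measurable_component_singleton)
  then show ?thesis
    by (subst borel_measurable_euclidean_space) (auto simp: Basis_vec_def inner_axis)
qed

text \<open>The change of variables from \<open>y\<close> to its complement \<open>1 - y\<close>,
  combined with a relabelling of the coordinates. It links integrals over \<open>y\<close> to the
  functions on \<open>{1..m}\<close> on which \<open>mu\<close> lives.\<close>

lemma lborel_vec_reflect:
  fixes b :: "'m::finite \<Rightarrow> 'b"
  assumes b: "bij_betw b UNIV I"
  shows "(lborel :: (real^'m) measure) = distr (PiM I (\<lambda>_. lborel)) borel (\<lambda>f. \<chi> i. 1 - f (b i))"
proof (rule lborel_eqI)
  interpret product_sigma_finite "\<lambda>_. lborel :: real measure" by standard
  have I: "finite I" using bij_betw_finite[OF b] by simp
  let ?N = "PiM I (\<lambda>_. lborel :: real measure)"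
  have bI: "b i \<in> I" for i using bij_betwE[OF b] by simp
  fix l u :: "real^'m"
  assume le: "\<And>b. b \<in> Basis \<Longrightarrow> l \<bullet> b \<le> u \<bullet> b"
  have le': "l $ i \<le> u $ i" for i
    using le[of "axis i 1"] by (simp add: Basis_vec_real inner_axis)
  define c where "c = inv_into UNIV b"
  have cb: "c (b i) = i" for i
    unfolding c_def by (rule bij_betw_inv_into_left[OF b]) simp
  have bc: "k \<in> I \<Longrightarrow> b (c k) = k" for k
    unfolding c_def by (rule bij_betw_inv_into_right[OF b])
  have pre: "(\<lambda>f. \<chi> i. 1 - f (b i)) -` box l u \<inter> space ?N = Pi\<^sub>E I (\<lambda>k. {1 - u $ c k <..< 1 - l $ c k})"
    (is "?L = ?R")
  proof -
    have "f \<in> ?L \<longleftrightarrow> f \<in> extensional I \<and> (\<forall>i. 1 - u $ i < f (b i) \<and> f (b i) < 1 - l $ i)" for f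
    proof -
      have "(\<chi> i. 1 - f (b i)) \<in> box l u \<longleftrightarrow> (\<forall>i. l $ i < 1 - f (b i) \<and> 1 - f (b i) < u $ i)"
        by (simp add: mem_box_cart)
      also have "\<dots> \<longleftrightarrow> (\<forall>i. 1 - u $ i < f (b i) \<and> f (b i) < 1 - l $ i)"
        by (intro all_cong1) auto
      finally show ?thesis by (auto simp: space_PiM PiE_iff)
    qed
    moreover have "f \<in> ?R \<longleftrightarrow> f \<in> extensional I \<and> (\<forall>k\<in>I. 1 - u $ c k < f k \<and> f k < 1 - l $ c k)" for f
      by (auto simp: PiE_iff)
    moreover have K: "(\<forall>k\<in>I. P k (c k)) \<longleftrightarrow> (\<forall>i. P (b i) i)" for P :: "'b \<Rightarrow> 'm \<Rightarrow> bool"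
    proof (intro iffI allI ballI)
      fix i assume "\<forall>k\<in>I. P k (c k)"
      from bspec[OF this bI[of i]] show "P (b i) i" by (simp add: cb)
    next
      fix k assume P: "\<forall>i. P (b i) i" and k: "k \<in> I"
      from P[rule_format, of "c k"] show "P k (c k)" by (simp add: bc k)
    qed
    ultimately have "f \<in> ?L \<longleftrightarrow> f \<in> ?R" for f
      using K[of "\<lambda>k i. 1 - u $ i < f k \<and> f k < 1 - l $ i"] by simp
    then show ?thesis by blast
  qed
  have "emeasure (distr ?N borel (\<lambda>f. \<chi> i. 1 - f (b i))) (box l u)
     = emeasure ?N (Pi\<^sub>E I (\<lambda>k. {1 - u $ c k <..< 1 - l $ c k}))"
    by (subst emeasure_distr[OF measurable_vec_reflect[OF b]]) (simp_all add: pre)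
  also have "\<dots> = (\<Prod>k\<in>I. ennreal (u $ c k - l $ c k))"
    by (subst emeasure_PiM[OF I]) (auto simp: le')
  also have "\<dots> = (\<Prod>i\<in>UNIV. ennreal (u $ i - l $ i))"
    by (subst prod.reindex_bij_betw[OF b, symmetric]) (simp add: cb)
  also have "\<dots> = ennreal (\<Prod>i\<in>UNIV. u $ i - l $ i)"
    by (rule prod_ennreal) (auto simp: le')
  finally show "emeasure (distr ?N borel (\<lambda>f. \<chi> i. 1 - f (b i))) (box l u) = (\<Prod>b\<in>Basis. (u - l) \<bullet> b)"
    by (simp add: prod_Basis_vec)
qed simp

section \<open>The projected polytope, fibred over the cube of all y\<close>

definition cube :: "(real^'m) set" where
  "cube = {y. \<forall>i. 0 \<le> y $ i \<and> y $ i \<le> 1}"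

definition fibered :: "(real^'k::finite option) set \<Rightarrow> ((real^'n::finite^'k) \<times> (real^'k option)) set" where
  "fibered B = {(x, y). y \<in> cube \<inter> B \<and> (\<forall>j. (\<chi> i. x $ i $ j) \<in> slice (\<lambda>i. 1 - y $ i) UNIV)}"

text \<open>The deleted row is recovered as the \<open>None\<close> coordinate of each column, so
  its bounds become the \<open>None\<close> constraints of \<open>slice\<close>. The bound
  \<open>0 \<le> y $ i\<close> follows from \<open>0 \<le> x $ i $ j \<le> y $ i\<close>, as there
  is at least one column.\<close>

lemma P_D_image:
  "delete_last_row ` (P_set \<inter> D_set) = (fibered UNIV :: ((real^'n::finite^'k::finite) \<times> (real^'k option)) set)"
proof (intro set_eqI iffI)
  fix p :: "(real^'n^'k) \<times> (real^'k option)"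
  assume "p \<in> delete_last_row ` (P_set \<inter> D_set)"
  then obtain x y where xy: "(x, y) \<in> P_set \<inter> D_set" and p: "p = (\<chi> i. x $ Some i, y)"
    by (auto simp: delete_last_row_def)
  have "1 - (\<Sum>k\<in>UNIV. x $ Some k $ j) = x $ None $ j" for j
    using xy by (auto simp: D_set_def sum_option dest!: spec[of _ j])
  moreover have "0 \<le> y $ i" for i
    using xy by (auto simp: P_set_def intro: order.trans)
  ultimately show "p \<in> fibered UNIV"
    using xy by (auto simp: p fibered_def slice_def cube_def P_set_def bary_def split: option.splits)
next
  fix p :: "(real^'n^'k) \<times> (real^'k option)"
  assume a: "p \<in> fibered UNIV"
  obtain x y where p: "p = (x, y)" by force
  define x' :: "real^'n^'k option" where "x' = (\<chi> i j. bary (\<chi> k. x $ k $ j) i)"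
  have "(x', y) \<in> P_set \<inter> D_set"
    using a by (auto simp: p x'_def fibered_def slice_def cube_def P_set_def D_set_def sum_bary)
  moreover have "delete_last_row (x', y) = p"
    by (simp add: delete_last_row_def p x'_def bary_def vec_eq_iff)
  ultimately show "p \<in> delete_last_row ` (P_set \<inter> D_set)" by force
qed

lemma closed_fibered_UNIV:
  "closed (fibered UNIV :: ((real^'n::finite^'k::finite) \<times> (real^'k option)) set)"
proof -
  have c: "continuous_on UNIV (\<lambda>p :: (real^'n^'k) \<times> (real^'k option). bary (\<chi> i. fst p $ i $ j) k)" for j k
    by (rule continuous_on_compose2[OF continuous_bary]) (auto intro!: continuous_intros)
  have "(fibered UNIV :: ((real^'n^'k) \<times> (real^'k option)) set)
    = (\<Inter>i. {p. 0 \<le> snd p $ i} \<inter> {p. snd p $ i \<le> 1}) \<inter>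
      (\<Inter>j k. {p. 0 \<le> bary (\<chi> i. fst p $ i $ j) k} \<inter> {p. bary (\<chi> i. fst p $ i $ j) k \<le> snd p $ k})"
    by (force simp: fibered_def cube_def slice_def)
  also have "closed \<dots>"
    by (intro closed_Int closed_INT ballI closed_Collect_le c continuous_intros)
  finally show ?thesis .
qed

lemma closed_cube: "closed (cube :: (real^'m::finite) set)"
proof -
  have "(cube :: (real^'m) set) = (\<Inter>i. {y. 0 \<le> y $ i} \<inter> {y. y $ i \<le> 1})"
    by (auto simp: cube_def)
  also have "closed \<dots>" by (intro closed_Int closed_INT ballI closed_Collect_le continuous_intros)
  finally show ?thesis .
qed

lemma fibered_Int: "fibered B = fibered UNIV \<inter> (UNIV \<times> B)"
  by (auto simp: fibered_def)

lemma sets_fibered: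
  assumes "B \<in> sets borel"
  shows "(fibered B :: ((real^'n::finite^'k::finite) \<times> (real^'k option)) set) \<in> sets borel"
proof -
  have "(UNIV \<times> B :: ((real^'n^'k) \<times> (real^'k option)) set) = snd -` B \<inter> space borel" by auto
  also have "\<dots> \<in> sets borel"
    by (rule measurable_sets[OF _ assms]) (intro borel_measurable_continuous_onI continuous_intros)
  finally show ?thesis
    unfolding fibered_Int[of B] using borel_closed[OF closed_fibered_UNIV] by blast
qed

definition slice_vol :: "real^('k::finite option) \<Rightarrow> real" where
  "slice_vol y = measure lebesgue (slice (\<lambda>i. 1 - y $ i) UNIV)"

lemma emeasure_slice: "emeasure lborel (slice e A :: (real^'k::finite) set) = ennreal (measure lebesgue (slice e A))"
proof -
  have "emeasure lborel (slice e A :: (real^'k::finite) set) = emeasure lebesgue (slice e A)"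
    using borel_closed[OF closed_slice, of e A] by (subst emeasure_completion) auto
  also have "\<dots> = ennreal (measure lebesgue (slice e A))"
    using lmeasurable_slice by (intro emeasure_eq_measure2)
  finally show ?thesis .
qed

text \<open>The case of a single column, which yields measurability of \<^term>\<open>slice_vol\<close>.\<close>

lemma slice_vol_eq:
  fixes y :: "real^'k::finite option"
  assumes "y \<in> cube"
  shows "ennreal (slice_vol y) = emeasure lborel ((\<lambda>x::real^1^'k. (x, y)) -` fibered UNIV)"
proof -
  have "(\<lambda>x::real^1^'k. (x, y)) -` fibered UNIV = {x. \<forall>j. (\<chi> i. x $ i $ j) \<in> slice (\<lambda>i. 1 - y $ i) UNIV}"
    using assms by (auto simp: fibered_def)
  then show ?thesis
    by (simp only: emeasure_columns[OF borel_closed[OF closed_slice]] emeasure_slice slice_vol_def) simp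
qed

text \<open>Section measures of a Borel set are measurable. The indicator is present because outside
  the cube the sections are empty and do not give \<open>slice_vol\<close>.\<close>

lemma slice_vol_measurable: "(\<lambda>y::real^'k::finite option. indicator cube y * slice_vol y) \<in> borel_measurable borel"
proof -
  have c: "(cube :: (real^'k option) set) \<in> sets borel" by (rule borel_closed[OF closed_cube])
  have s: "(fibered UNIV :: ((real^1^'k) \<times> (real^'k option)) set) \<in> sets (lborel \<Otimes>\<^sub>M lborel)"
    unfolding lborel_prod using sets_fibered[of UNIV] by simp
  have "(\<lambda>y::real^'k option. emeasure lborel ((\<lambda>x::real^1^'k. (x, y)) -` fibered UNIV)) \<in> borel_measurable lborel"
    by (rule lborel_pair.measurable_emeasure_Pair2[OF s])
  then have "(\<lambda>y::real^'k option. indicator cube y * enn2real (emeasure lborel ((\<lambda>x::real^1^'k. (x, y)) -` fibered UNIV))) \<in> borel_measurable borel"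
    using c by simp
  also have "(\<lambda>y::real^'k option. indicator cube y * enn2real (emeasure lborel ((\<lambda>x::real^1^'k. (x, y)) -` fibered UNIV)))
     = (\<lambda>y. indicator cube y * slice_vol y)"
    by (auto simp: fun_eq_iff indicator_def slice_vol_def simp flip: slice_vol_eq)
  finally show ?thesis .
qed

lemma slice_vol_power_measurable:
  fixes B :: "(real^'k::finite option) set"
  assumes B: "B \<in> sets borel"
  shows "(\<lambda>y. indicator (cube \<inter> B) y * slice_vol y ^ n) \<in> borel_measurable borel"
proof -
  have "(\<lambda>y. indicator (cube \<inter> B) y * (indicator cube y * slice_vol y) ^ n) \<in> borel_measurable borel"
    by (intro borel_measurable_times borel_measurable_power slice_vol_measurable borel_measurable_indicator
        sets.Int B borel_closed[OF closed_cube])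
  also have "(\<lambda>y. indicator (cube \<inter> B) y * (indicator cube y * slice_vol y) ^ n)
    = (\<lambda>y. indicator (cube \<inter> B) y * slice_vol y ^ n)"
    by (auto simp: indicator_def fun_eq_iff)
  finally show ?thesis .
qed

text \<open>Tonelli: above each \<open>y\<close> the columns are independent, so the fibre has the
  volume of one slice to the power \<open>CARD('n)\<close>.\<close>

lemma measure_fibered:
  fixes B :: "(real^'k::finite option) set"
  assumes B: "B \<in> sets borel"
  shows "measure lebesgue (fibered B :: ((real^'n::finite^'k) \<times> (real^'k option)) set)
    = (LINT y|lborel. indicator (cube \<inter> B) y * slice_vol y ^ CARD('n))"
proof -
  have m: "(fibered B :: ((real^'n^'k) \<times> (real^'k option)) set) \<in> sets (lborel \<Otimes>\<^sub>M lborel)"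
    unfolding lborel_prod using sets_fibered[OF B] by simp
  note meas = slice_vol_power_measurable[OF B, of "CARD('n)"]
  have "measure lebesgue (fibered B :: ((real^'n^'k) \<times> (real^'k option)) set)
     = enn2real (emeasure (lborel \<Otimes>\<^sub>M lborel) (fibered B :: ((real^'n^'k) \<times> (real^'k option)) set))"
    unfolding lborel_prod measure_def using sets_fibered[OF B] by (subst emeasure_completion) auto
  also have "emeasure (lborel \<Otimes>\<^sub>M lborel) (fibered B :: ((real^'n^'k) \<times> (real^'k option)) set)
     = (\<integral>\<^sup>+y. emeasure lborel ((\<lambda>x::real^'n^'k. (x, y)) -` fibered B) \<partial>lborel)"
    by (rule lborel_pair.emeasure_pair_measure_alt2[OF m])
  also have "\<dots> = (\<integral>\<^sup>+y. ennreal (indicator (cube \<inter> B) y * slice_vol y ^ CARD('n)) \<partial>lborel)"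
  proof (intro nn_integral_cong)
    fix y :: "real^'k option"
    show "emeasure lborel ((\<lambda>x::real^'n^'k. (x, y)) -` fibered B) = ennreal (indicator (cube \<inter> B) y * slice_vol y ^ CARD('n))"
    proof (cases "y \<in> cube \<inter> B")
      case True
      then have "(\<lambda>x::real^'n^'k. (x, y)) -` fibered B = {x. \<forall>j. (\<chi> i. x $ i $ j) \<in> slice (\<lambda>i. 1 - y $ i) UNIV}"
        by (auto simp: fibered_def)
      with True show ?thesis
        by (simp add: emeasure_columns borel_closed closed_slice emeasure_slice slice_vol_def ennreal_power)
    next
      case False
      then have "(\<lambda>x::real^'n^'k. (x, y)) -` fibered B = {}"
        by (auto simp: fibered_def)
      with False show ?thesis by simp
    qed
  qed
  also have "enn2real \<dots> = (LINT y|lborel. indicator (cube \<inter> B) y * slice_vol y ^ CARD('n))"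
    by (intro integral_eq_nn_integral[symmetric]) (use meas in \<open>auto simp: slice_vol_def\<close>)
  finally show ?thesis .
qed

section \<open>One-dimensional integrals and the product law\<close>

text \<open>The density of \<open>eps_law\<close> before normalisation, with
  \<open>p = m - 1\<close>; \<open>cut_integral\<close> is its total mass.\<close>

definition cut_pow :: "nat \<Rightarrow> nat \<Rightarrow> real \<Rightarrow> real" where
  "cut_pow p n t = indicator {0..1} t * (1 - t ^ p) ^ n"

definition cut_integral :: "nat \<Rightarrow> nat \<Rightarrow> real" where
  "cut_integral p n = (LINT t|lborel. cut_pow p n t)"

lemma integrable_Icc_continuous:
  fixes h :: "real \<Rightarrow> real"
  assumes "continuous_on UNIV h"
  shows "integrable lborel (\<lambda>t. indicator {a..b} t * h t)"
  using borel_integrable_atLeastAtMost'[OF continuous_on_subset[OF assms subset_UNIV], of a b]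
  by (simp add: set_integrable_def)

lemma cut_pow_measurable [measurable]: "cut_pow p n \<in> borel_measurable borel"
  unfolding cut_pow_def[abs_def] by measurable

lemma integrable_cut_pow: "integrable lborel (cut_pow p n)"
  unfolding cut_pow_def[abs_def] by (intro integrable_Icc_continuous continuous_intros)

lemma integrable_cut_pow_times: "integrable lborel (\<lambda>t. cut_pow p n t * t ^ k)"
  unfolding cut_pow_def[abs_def] mult.assoc by (intro integrable_Icc_continuous continuous_intros)

lemma cut_pow_nonneg: "0 \<le> cut_pow p n t"
  by (auto simp: cut_pow_def indicator_def power_le_one)

lemma cut_integral_pos:
  assumes "p \<ge> 1"
  shows "0 < cut_integral p n"
proof -
  have "0 < (1/2)^n * (1/2 :: real)" by simp
  also have "\<dots> = (LINT t|lborel. indicator {0..1/2::real} t * (1/2)^n)" by simp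
  also have "\<dots> \<le> cut_integral p n"
    unfolding cut_integral_def
  proof (rule integral_mono)
    fix t :: real
    have "t ^ p \<le> 1 / 2" if "0 \<le> t" "t \<le> 1/2"
      using power_decreasing[of 1 p t] assms that by simp
    then have "(1/2) ^ n \<le> (1 - t ^ p) ^ n" if "0 \<le> t" "t \<le> 1/2"
      using that by (intro power_mono) auto
    then show "indicator {0..1/2} t * (1/2)^n \<le> cut_pow p n t"
      using cut_pow_nonneg[of p n t] by (auto simp: cut_pow_def indicator_def)
  qed (use integrable_cut_pow integrable_Icc_continuous[of "\<lambda>_. (1/2)^n"] in auto)
  finally show ?thesis .
qed

text \<open>Integrate the derivative of \<open>t * (1 - t ^ p) ^ n\<close>, which vanishes at both
  ends of the unit interval.\<close>

lemma cut_integral_by_parts: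
  assumes "n \<ge> 1"
  shows "(LINT t|lborel. cut_pow p (n - 1) t * t ^ p) * (real n * real p) = cut_integral p n"
proof -
  have "(LINT t|lborel. ((1 - t ^ p) ^ n - real n * real p * ((1 - t ^ p) ^ (n - 1) * t ^ p)) * indicator {0..1} t)
      = 1 * (1 - 1 ^ p) ^ n - 0 * (1 - 0 ^ p) ^ n"
  proof (rule integral_FTC_Icc_real)
    fix t :: real
    have "((\<lambda>t. t * (1 - t ^ p) ^ n) has_real_derivative
      (1 - t ^ p) ^ n + t * (real n * (1 - t ^ p) ^ (n - 1) * (- (real p * t ^ (p - 1))))) (at t)"
      by (rule derivative_eq_intros refl | simp)+
    \<comment> \<open>For \<open>p = 0\<close> the powers of \<open>t\<close> do not match, but the
      factor \<open>real p\<close> vanishes.\<close>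
    also have "t * (real n * (1 - t ^ p) ^ (n - 1) * (- (real p * t ^ (p - 1))))
       = - (real n * real p * ((1 - t ^ p) ^ (n - 1) * t ^ p))"
      by (cases p) auto
    finally show "((\<lambda>t. t * (1 - t ^ p) ^ n) has_real_derivative
      (1 - t ^ p) ^ n - real n * real p * ((1 - t ^ p) ^ (n - 1) * t ^ p)) (at t)" by simp
  qed (simp_all add: continuous_intros)
  also have "\<dots> = 0" using assms by simp
  also have "(\<lambda>t. ((1 - t ^ p) ^ n - real n * real p * ((1 - t ^ p) ^ (n - 1) * t ^ p)) * indicator {0..1} t)
     = (\<lambda>t. cut_pow p n t - real n * real p * (cut_pow p (n - 1) t * t ^ p))"
    by (simp add: fun_eq_iff cut_pow_def left_diff_distrib right_diff_distrib mult_ac)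
  finally show ?thesis
    using integrable_cut_pow[of p n] integrable_cut_pow_times[of p "n - 1" p]
    by (simp add: cut_integral_def)
qed

lemma cut_integral_pred:
  assumes "n \<ge> 1"
  shows "cut_integral p (n - 1) = cut_integral p n + (LINT t|lborel. cut_pow p (n - 1) t * t ^ p)"
proof -
  have "cut_pow p (n - 1) t = cut_pow p n t + cut_pow p (n - 1) t * t ^ p" for t
    using assms by (cases n) (auto simp: cut_pow_def algebra_simps)
  then have "cut_integral p (n - 1) = (LINT t|lborel. cut_pow p n t + cut_pow p (n - 1) t * t ^ p)"
    unfolding cut_integral_def by (intro Bochner_Integration.integral_cong) auto
  then show ?thesis
    by (simp add: cut_integral_def integrable_cut_pow integrable_cut_pow_times)
qed

section \<open>Bonferroni's inequality and the lower bound for the integral\<close>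

lemma prod_one_minus_le:
  fixes u :: "'a \<Rightarrow> real"
  assumes "finite I" "\<And>i. i \<in> I \<Longrightarrow> 0 \<le> u i \<and> u i \<le> 1"
  shows "(\<Prod>i\<in>I. 1 - u i) \<le> 1 - sum u I + (\<Sum>i\<in>I. \<Sum>k\<in>I - {i}. u i * u k)"
  using assms
proof (induction I rule: finite_induct)
  case (insert a I)
  \<comment> \<open>The sum runs over ordered pairs and is thus twice the usual Bonferroni term. A
    new index adds \<open>2 * (u a * sum u I)\<close>, of which the induction step consumes one
    half.\<close>
  let ?S = "\<lambda>I. \<Sum>i\<in>I. \<Sum>k\<in>I - {i}. u i * u k"
  have "?S (insert a I) = u a * sum u I + (\<Sum>i\<in>I. \<Sum>k\<in>insert a (I - {i}). u i * u k)"
    using insert.hyps by (simp add: sum_distrib_left insert_Diff_if) (intro sum.cong; auto)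
  also have "(\<Sum>i\<in>I. \<Sum>k\<in>insert a (I - {i}). u i * u k) = (\<Sum>i\<in>I. u i * u a + (\<Sum>k\<in>I - {i}. u i * u k))"
    using insert.hyps by (intro sum.cong refl) auto
  also have "\<dots> = u a * sum u I + ?S I"
    by (simp add: sum.distrib sum_distrib_left mult.commute)
  finally have S: "?S (insert a I) = ?S I + 2 * (u a * sum u I)" by simp
  have W: "1 - sum u I \<le> (\<Prod>i\<in>I. 1 - u i)"
    by (rule Weierstrass_prod_ineq) (use insert in auto)
  have "(\<Prod>i\<in>insert a I. 1 - u i) = (\<Prod>i\<in>I. 1 - u i) - u a * (\<Prod>i\<in>I. 1 - u i)"
    using insert.hyps by (simp add: algebra_simps)
  also have "\<dots> \<le> (1 - sum u I + ?S I) - u a * (1 - sum u I)"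
    using insert W by (intro diff_mono mult_left_mono) auto
  also have "\<dots> \<le> 1 - sum u (insert a I) + ?S (insert a I)"
    using S insert.prems insert.hyps by (simp add: algebra_simps sum_nonneg)
  finally show ?case .
qed simp

lemma power_diff_le:
  fixes a b :: real
  assumes "0 \<le> a" "a \<le> b"
  shows "b ^ n - a ^ n \<le> real n * b ^ (n - 1) * (b - a)"
proof (induction n)
  case (Suc n)
  have "b ^ Suc n - a ^ Suc n = b * (b ^ n - a ^ n) + a ^ n * (b - a)"
    by (simp add: algebra_simps)
  also have "\<dots> \<le> b * (real n * b ^ (n - 1) * (b - a)) + b ^ n * (b - a)"
    using Suc assms by (intro add_mono mult_left_mono mult_right_mono power_mono) auto
  also have "b * (real n * b ^ (n - 1) * (b - a)) = real n * b ^ n * (b - a)"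
    by (cases n) auto
  finally show ?case by (simp add: algebra_simps)
qed simp

text \<open>This is \<open>power_diff_le\<close> between the product and the positive part of the
  union bound, whose difference Bonferroni controls. The correction is written as a sum of products
  over \<open>I\<close> so that its integral factorises.\<close>

lemma dirichlet_lower_pointwise:
  fixes u :: "'a \<Rightarrow> real"
  assumes "finite I" "\<And>i. i \<in> I \<Longrightarrow> 0 \<le> u i \<and> u i \<le> 1"
  shows "(\<Prod>i\<in>I. (1 - u i) ^ n)
     - real n * (\<Sum>i\<in>I. \<Sum>k\<in>I - {i}. u i * u k * (\<Prod>l\<in>I. (1 - u l) ^ (n - 1)))
     \<le> (max 0 (1 - sum u I)) ^ n"
proof -
  let ?B = "\<Prod>i\<in>I. 1 - u i" and ?A = "max 0 (1 - sum u I)" and ?S = "\<Sum>i\<in>I. \<Sum>k\<in>I - {i}. u i * u k"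
  have B: "0 \<le> ?B" using assms by (intro prod_nonneg) auto
  have AB: "?A \<le> ?B" using Weierstrass_prod_ineq[of I u] assms B by auto
  have "?B - ?A \<le> ?S" using prod_one_minus_le[of I u] assms by simp
  then have "real n * ?B ^ (n - 1) * (?B - ?A) \<le> real n * ?B ^ (n - 1) * ?S"
    using B by (intro mult_left_mono) auto
  with power_diff_le[of ?A ?B n] AB show ?thesis
    by (simp add: prod_power_distrib sum_distrib_left sum_distrib_right mult_ac)
qed

interpretation lborel_power: product_sigma_finite "\<lambda>_. lborel :: real measure"
  by standard

text \<open>Write \<open>Z\<close> for \<open>cut_integral p n\<close>. Each of the
  \<open>(p + 1) * p\<close> ordered pairs integrates to
  \<open>W\<^sup>2 * cut_integral p (n - 1) ^ (p - 1)\<close>. Integration by parts gives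
  \<open>W = Z / (n * p)\<close>, hence
  \<open>cut_integral p (n - 1) = Z * (1 + 1 / (n * p))\<close>. The relative loss is
  \<open>(p + 1) / p * (1 + 1 / (n * p)) ^ (p - 1) / n\<close>, at most
  \<open>2 * 3 / n\<close>.\<close>

lemma dirichlet_lower:
  fixes I :: "'a set"
  assumes p: "p \<ge> 1" and n: "n \<ge> 1" and I: "finite I" "card I = Suc p"
  assumes g: "integrable (PiM I (\<lambda>_. lborel)) g"
    and g_ge: "\<And>f. (\<Prod>i\<in>I. indicator {0..1} (f i)) * (max 0 (1 - (\<Sum>i\<in>I. f i ^ p))) ^ n \<le> g f"
  shows "cut_integral p n ^ Suc p * (1 - 6 / real n) \<le> integral\<^sup>L (PiM I (\<lambda>_. lborel)) g"
proof -
  let ?N = "PiM I (\<lambda>_. lborel :: real measure)"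
  define W where "W = (LINT t|lborel. cut_pow p (n - 1) t * t ^ p)"
  \<comment> \<open>The factor at \<open>l\<close> of the term for the pair \<open>i\<close>,
    \<open>k\<close>: the extra power of \<open>t\<close> appears only at these two indices.\<close>
  define h where "h i k l = (\<lambda>t. cut_pow p (n - 1) t * t ^ (if l = i \<or> l = k then p else 0))" for i k l :: 'a
  have Z: "0 < cut_integral p n" using p by (rule cut_integral_pos)
  have hint: "integrable lborel (h i k l)" for i k l
    unfolding h_def by (rule integrable_cut_pow_times)
  let ?r = "\<lambda>f. (\<Prod>i\<in>I. cut_pow p n (f i)) - real n * (\<Sum>i\<in>I. \<Sum>k\<in>I - {i}. \<Prod>l\<in>I. h i k l (f l))"
  have int1: "integrable ?N (\<lambda>f. \<Prod>i\<in>I. cut_pow p n (f i))"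
    using I by (intro lborel_power.product_integrable_prod integrable_cut_pow)
  have int2: "integrable ?N (\<lambda>f. \<Prod>l\<in>I. h i k l (f l))" for i k
    using I by (intro lborel_power.product_integrable_prod hint)
  have hval: "(LINT f|?N. (\<Prod>l\<in>I. h i k l (f l))) = W\<^sup>2 * cut_integral p (n - 1) ^ (p - 1)"
    if "i \<in> I" "k \<in> I - {i}" for i k
  proof -
    have "(LINT f|?N. (\<Prod>l\<in>I. h i k l (f l))) = (\<Prod>l\<in>I. integral\<^sup>L lborel (h i k l))"
      using I by (intro lborel_power.product_integral_prod hint)
    also have "\<dots> = (\<Prod>l\<in>I. if l \<in> {i, k} then W else cut_integral p (n - 1))"
      by (intro prod.cong) (auto simp: h_def W_def cut_integral_def)
    also have "\<dots> = W ^ card (I \<inter> {i, k}) * cut_integral p (n - 1) ^ card (I - {i, k})"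
      using I by (simp only: prod.If_cases Diff_eq Collect_mem_eq prod_constant Int_def[symmetric])
    also have "I \<inter> {i, k} = {i, k}" using that by auto
    also have ik: "card {i, k} = 2" using that by auto
    also have "card (I - {i, k}) = p - 1" using that I by (simp add: card_Diff_subset ik del: card_insert_disjoint)
    finally show ?thesis .
  qed
  have "integral\<^sup>L ?N ?r = (\<Prod>i\<in>I. integral\<^sup>L lborel (cut_pow p n))
      - real n * (\<Sum>i\<in>I. \<Sum>k\<in>I - {i}. LINT f|?N. (\<Prod>l\<in>I. h i k l (f l)))"
    using int1 int2 lborel_power.product_integral_prod[OF I(1), of "\<lambda>_. cut_pow p n"]
    by (simp add: integrable_cut_pow del: prod_constant)
  also have "\<dots> = cut_integral p n ^ Suc p - real n * (real (Suc p) * (real p * (W\<^sup>2 * cut_integral p (n - 1) ^ (p - 1))))"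
  proof -
    have "(\<Sum>i\<in>I. \<Sum>k\<in>I - {i}. LINT f|?N. (\<Prod>l\<in>I. h i k l (f l)))
       = (\<Sum>i\<in>I. \<Sum>k\<in>I - {i}. W\<^sup>2 * cut_integral p (n - 1) ^ (p - 1))"
      by (intro sum.cong refl hval)
    then show ?thesis
      using I by (simp add: cut_integral_def[symmetric])
  qed
  finally have r: "integral\<^sup>L ?N ?r = cut_integral p n ^ Suc p - real n * (real (Suc p) * (real p * (W\<^sup>2 * cut_integral p (n - 1) ^ (p - 1))))" .
  have Wval: "W = cut_integral p n / (real n * real p)"
    using cut_integral_by_parts[OF n, of p] n p by (simp add: W_def field_simps)
  have Zval: "cut_integral p (n - 1) = cut_integral p n * (1 + 1 / (real n * real p))"
    using cut_integral_pred[OF n, of p] unfolding W_def[symmetric] Wval by (simp add: algebra_simps)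
  \<comment> \<open>The power is at most \<open>exp (1 / n)\<close>, which is bounded by
    \<open>exp 1 \<le> 3\<close> uniformly in \<open>p\<close>.\<close>
  have e3: "(1 + 1 / (real n * real p)) ^ (p - 1) \<le> 3"
  proof -
    have "(1 + 1 / (real n * real p)) ^ (p - 1) \<le> (1 + 1 / (real n * real p)) ^ p"
      by (intro power_increasing) auto
    also have "\<dots> \<le> exp (1 / (real n * real p)) ^ p"
      by (intro power_mono exp_ge_add_one_self) auto
    also have "\<dots> = exp (1 / real n)" using p by (simp flip: exp_of_nat_mult)
    also have "\<dots> \<le> exp 1" using n by simp
    also have "\<dots> \<le> 3" by (rule exp_le)
    finally show ?thesis .
  qed
  have "real n * (real (Suc p) * (real p * (W\<^sup>2 * cut_integral p (n - 1) ^ (p - 1))))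
     = cut_integral p n ^ Suc p * ((real (Suc p) / real p) * (1 + 1 / (real n * real p)) ^ (p - 1) / real n)"
  proof -
    have eq: "a * ((p' + 1) * (p' * ((z / (a * p'))\<^sup>2 * (q * c)))) = (z * z * q) * ((p' + 1) / p' * c / a)"
      if "a \<noteq> 0" "p' \<noteq> 0" for a p' z q c :: real
      using that by (simp add: power2_eq_square mult_ac)
    have "cut_integral p n * cut_integral p n * cut_integral p n ^ (p - 1) = cut_integral p n ^ Suc p"
      using p by (cases p) auto
    then show ?thesis
      using eq[of "real n" "real p" "cut_integral p n" "cut_integral p n ^ (p - 1)" "(1 + 1 / (real n * real p)) ^ (p - 1)"] p n
      unfolding Wval Zval power_mult_distrib by (simp add: add.commute)
  qed
  also have "\<dots> \<le> cut_integral p n ^ Suc p * (2 * 3 / real n)"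
    using p n Z e3 by (intro mult_left_mono divide_right_mono mult_mono) (auto simp: field_simps)
  finally have "cut_integral p n ^ Suc p * (1 - 6 / real n) \<le> integral\<^sup>L ?N ?r"
    unfolding r by (simp add: algebra_simps)
  also have "\<dots> \<le> integral\<^sup>L ?N g"
  proof (rule integral_mono)
    show "integrable ?N ?r" using int1 int2 by auto
    fix f :: "'a \<Rightarrow> real"
    show "?r f \<le> g f"
    proof (cases "\<forall>i\<in>I. f i \<in> {0..1}")
      case True
      have "?r f = (\<Prod>i\<in>I. (1 - f i ^ p) ^ n) - real n * (\<Sum>i\<in>I. \<Sum>k\<in>I - {i}. f i ^ p * f k ^ p * (\<Prod>l\<in>I. (1 - f l ^ p) ^ (n - 1)))"
      proof -
        have "(\<Prod>l\<in>I. h i k l (f l)) = f i ^ p * f k ^ p * (\<Prod>l\<in>I. (1 - f l ^ p) ^ (n - 1))"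
          if "i \<in> I" "k \<in> I - {i}" for i k
        proof -
          have "(\<Prod>l\<in>I. f l ^ (if l = i \<or> l = k then p else 0)) = (\<Prod>l\<in>{i,k}. f l ^ p)"
            using that I by (intro prod.mono_neutral_cong_right) auto
          also have "\<dots> = f i ^ p * f k ^ p" using that by auto
          finally show ?thesis
            using True that by (simp add: h_def cut_pow_def prod.distrib)
        qed
        moreover have "(\<Prod>i\<in>I. cut_pow p n (f i)) = (\<Prod>i\<in>I. (1 - f i ^ p) ^ n)"
          using True by (intro prod.cong) (auto simp: cut_pow_def)
        ultimately show ?thesis by simp
      qed
      also have "\<dots> \<le> (max 0 (1 - (\<Sum>i\<in>I. f i ^ p))) ^ n"
        using True I by (intro dirichlet_lower_pointwise) (auto simp: power_le_one)
      also have "\<dots> \<le> g f" using g_ge[of f] True by simp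
      finally show ?thesis .
    next
      case False
      \<comment> \<open>Outside the unit cube every product vanishes, and \<open>g_ge\<close> then
        says that \<open>g\<close> is nonnegative.\<close>
      then obtain a where a: "a \<in> I" "f a \<notin> {0..1}" by auto
      then have "(\<Prod>i\<in>I. cut_pow p n (f i)) = 0" "(\<Prod>l\<in>I. h i k l (f l)) = 0" "(\<Prod>i\<in>I. indicator {0..1} (f i) :: real) = 0" for i k
        using I by (intro prod_zero bexI[of _ a]; simp add: h_def cut_pow_def)+
      then show ?thesis using g_ge[of f] by simp
    qed
  qed (rule g)
  finally show ?thesis .
qed

section \<open>The law mu as a density with respect to Lebesgue measure\<close>

lemma eps_law_eq:
  "eps_law m n = density lborel (\<lambda>e. ennreal (cut_pow (m - 1) n e / cut_integral (m - 1) n))"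
  by (simp add: eps_law_def cut_pow_def cut_integral_def set_lebesgue_integral_def)

lemma sets_eps_law [simp, measurable_cong]: "sets (eps_law m n) = sets borel"
  by (simp add: eps_law_def)

lemma prob_space_eps_law:
  assumes "m \<ge> 2"
  shows "prob_space (eps_law m n)"
proof
  have Z: "0 < cut_integral (m - 1) n" using assms by (intro cut_integral_pos) auto
  have "emeasure (eps_law m n) (space (eps_law m n)) = (\<integral>\<^sup>+e. ennreal (cut_pow (m - 1) n e / cut_integral (m - 1) n) \<partial>lborel)"
    by (simp add: eps_law_eq emeasure_density)
  also have "\<dots> = ennreal (LINT e|lborel. cut_pow (m - 1) n e / cut_integral (m - 1) n)"
    using Z by (intro nn_integral_eq_integral) (auto simp: cut_pow_nonneg integrable_cut_pow)
  also have "\<dots> = 1" using Z by (simp add: cut_integral_def[symmetric])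
  finally show "emeasure (eps_law m n) (space (eps_law m n)) = 1" .
qed

text \<open>Both measures are compared on rectangles, where the integral of the product density
  factorises.\<close>

lemma mu_eq:
  assumes "m \<ge> 2"
  shows "mu m n = density (PiM {1..m} (\<lambda>_. lborel))
     (\<lambda>f. ennreal (\<Prod>i\<in>{1..m}. cut_pow (m - 1) n (f i) / cut_integral (m - 1) n))"
proof -
  have Z: "0 < cut_integral (m - 1) n" using assms by (intro cut_integral_pos) auto
  interpret prob_space "eps_law m n" using assms by (rule prob_space_eps_law)
  interpret product_sigma_finite "\<lambda>_::nat. eps_law m n" by standard
  show ?thesis
    unfolding mu_def
  proof (rule PiM_eqI[symmetric])
    show "sets (density (PiM {1..m} (\<lambda>_. lborel)) (\<lambda>f. ennreal (\<Prod>i\<in>{1..m}. cut_pow (m - 1) n (f i) / cut_integral (m - 1) n)))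
       = sets (PiM {1..m} (\<lambda>_. eps_law m n))"
      by (simp cong: sets_PiM_cong)
    fix A :: "nat \<Rightarrow> real set" assume A: "\<And>i. i \<in> {1..m} \<Longrightarrow> A i \<in> sets (eps_law m n)"
    let ?d = "\<lambda>t. ennreal (cut_pow (m - 1) n t / cut_integral (m - 1) n)"
    have A'[measurable]: "\<And>i. i \<in> {1..m} \<Longrightarrow> A i \<in> sets borel" using A by simp
    have "emeasure (density (PiM {1..m} (\<lambda>_. lborel)) (\<lambda>f. ennreal (\<Prod>i\<in>{1..m}. cut_pow (m - 1) n (f i) / cut_integral (m - 1) n))) (Pi\<^sub>E {1..m} A)
       = (\<integral>\<^sup>+f. ennreal (\<Prod>i\<in>{1..m}. cut_pow (m - 1) n (f i) / cut_integral (m - 1) n) * indicator (Pi\<^sub>E {1..m} A) f \<partial>PiM {1..m} (\<lambda>_. lborel))"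
      using A' by (intro emeasure_density) (auto intro!: sets_PiM_I_finite)
    also have "\<dots> = (\<integral>\<^sup>+f. (\<Prod>i\<in>{1..m}. ?d (f i) * indicator (A i) (f i)) \<partial>PiM {1..m} (\<lambda>_. lborel))"
    proof (intro nn_integral_cong)
      fix f :: "nat \<Rightarrow> real" assume "f \<in> space (PiM {1..m} (\<lambda>_. lborel))"
      then have "indicator (Pi\<^sub>E {1..m} A) f = (\<Prod>i\<in>{1..m}. indicator (A i) (f i) :: ennreal)"
        by (auto simp: space_PiM PiE_iff indicator_def prod_zero_iff)
      then show "ennreal (\<Prod>i\<in>{1..m}. cut_pow (m - 1) n (f i) / cut_integral (m - 1) n) * indicator (Pi\<^sub>E {1..m} A) f
         = (\<Prod>i\<in>{1..m}. ?d (f i) * indicator (A i) (f i))"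
        using Z by (simp add: prod.distrib prod_ennreal cut_pow_nonneg)
    qed
    also have "\<dots> = (\<Prod>i\<in>{1..m}. \<integral>\<^sup>+t. ?d t * indicator (A i) t \<partial>lborel)"
      by (intro lborel_power.product_nn_integral_prod) auto
    also have "\<dots> = (\<Prod>i\<in>{1..m}. emeasure (eps_law m n) (A i))"
      using A' by (intro prod.cong) (auto simp: eps_law_eq emeasure_density)
    finally show "emeasure (density (PiM {1..m} (\<lambda>_. lborel)) (\<lambda>f. ennreal (\<Prod>i\<in>{1..m}. cut_pow (m - 1) n (f i) / cut_integral (m - 1) n))) (Pi\<^sub>E {1..m} A)
       = (\<Prod>i\<in>{1..m}. emeasure (eps_law m n) (A i))" .
  qed simp
qed

lemma mu_tail:
  assumes "m \<ge> 2"
  shows "cut_integral (m - 1) n ^ m * measure (mu m n) {f \<in> space (mu m n). (\<Sum>i=1..m. f i) > 1}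
    = (LINT f|PiM {1..m} (\<lambda>_. lborel). indicator {f. (\<Sum>i=1..m. f i) > 1} f * (\<Prod>i\<in>{1..m}. cut_pow (m - 1) n (f i)))"
proof -
  have Z: "0 < cut_integral (m - 1) n" using assms by (intro cut_integral_pos) auto
  let ?N = "PiM {1..m} (\<lambda>_. lborel :: real measure)"
  let ?T = "{f \<in> space ?N. (\<Sum>i=1..m. f i) > 1}"
  let ?d = "\<lambda>f. \<Prod>i\<in>{1..m}. cut_pow (m - 1) n (f i) / cut_integral (m - 1) n"
  have nn: "0 \<le> ?d f" for f using Z by (intro prod_nonneg) (auto simp: cut_pow_nonneg)
  have T[measurable]: "?T \<in> sets ?N" by measurable
  have sp: "space (mu m n) = space ?N" by (simp add: mu_eq assms)
  have "measure (mu m n) {f \<in> space (mu m n). (\<Sum>i=1..m. f i) > 1}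
     = enn2real (\<integral>\<^sup>+f. ennreal (?d f) * indicator ?T f \<partial>?N)"
    unfolding sp by (simp add: measure_def mu_eq assms emeasure_density)
  also have "\<dots> = enn2real (\<integral>\<^sup>+f. ennreal (?d f * indicator ?T f) \<partial>?N)"
    unfolding ennreal_mult'[OF nn] ennreal_indicator ..
  also have "\<dots> = (LINT f|?N. ?d f * indicator ?T f)"
    by (intro integral_eq_nn_integral[symmetric] AE_I2 mult_nonneg_nonneg nn) simp_all
  also have "\<dots> = (LINT f|?N. indicator {f. (\<Sum>i=1..m. f i) > 1} f * (\<Prod>i\<in>{1..m}. cut_pow (m - 1) n (f i)) / cut_integral (m - 1) n ^ m)"
    by (intro Bochner_Integration.integral_cong) (auto simp: indicator_def prod_dividef)
  finally show ?thesis using Z by simp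
qed

section \<open>Volume estimates\<close>

lemma slice_vol_nonneg: "0 \<le> slice_vol y"
  by (simp add: slice_vol_def)

lemma slice_vol_le:
  fixes y :: "real^'k::finite option"
  assumes "y \<in> cube"
  shows "slice_vol y \<le> (\<Prod>i\<in>UNIV. 1 - (1 - y $ i) ^ CARD('k)) / fact CARD('k)"
  unfolding slice_vol_def by (rule measure_slice_le) (use assms in \<open>auto simp: cube_def\<close>)

lemma slice_vol_ge:
  fixes y :: "real^'k::finite option"
  assumes "y \<in> cube"
  shows "(1 - (\<Sum>i\<in>UNIV. (1 - y $ i) ^ CARD('k))) / fact CARD('k) \<le> slice_vol y"
  unfolding slice_vol_def by (rule measure_slice_ge) (use assms in \<open>auto simp: cube_def\<close>)

text \<open>The power mean inequality, obtained by applying Bernoulli to each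
  \<open>(1 + (m * e i - 1)) ^ p\<close>. The tangent is taken at \<open>e i = 1 / m\<close>, where
  equality holds.\<close>

lemma power_sum_ge:
  fixes e :: "'a \<Rightarrow> real"
  assumes "finite I" "card I = m" "m \<ge> 1" "\<And>i. i \<in> I \<Longrightarrow> 0 \<le> e i" "1 \<le> sum e I"
  shows "real m powi (1 - int p) \<le> (\<Sum>i\<in>I. e i ^ p)"
proof -
  have "real m \<le> real m + real p * (real m * sum e I - real m)"
    using assms by (simp add: mult_left_mono)
  also have "\<dots> = (\<Sum>i\<in>I. 1 + real p * (real m * e i - 1))"
    using assms by (simp add: sum.distrib sum_subtractf flip: sum_distrib_left)
  also have "\<dots> \<le> (\<Sum>i\<in>I. (1 + (real m * e i - 1)) ^ p)"
    using assms by (intro sum_mono Bernoulli_inequality) auto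
  also have "\<dots> = real m ^ p * (\<Sum>i\<in>I. e i ^ p)"
    by (simp add: power_mult_distrib sum_distrib_left)
  finally show ?thesis
    using assms(3) by (simp add: power_int_diff field_simps)
qed

text \<open>Combine \<open>1 - u \<le> exp (- u)\<close> in every factor with
  \<open>power_sum_ge\<close>. As \<open>m = p + 1\<close>, the exponents \<open>1 - p\<close> and
  \<open>2 - m\<close> agree.\<close>

lemma slice_vol_le_exp:
  fixes y :: "real^'k::finite option"
  assumes "y \<in> cube" "1 < (\<Sum>i\<in>UNIV. 1 - y $ i)"
  shows "slice_vol y \<le> exp (- (real CARD('k option) powi (2 - int CARD('k option)))) / fact CARD('k)"
proof -
  have y: "0 \<le> y $ i" "y $ i \<le> 1" for i using assms(1) by (auto simp: cube_def)
  have "(\<Prod>i\<in>UNIV. 1 - (1 - y $ i) ^ CARD('k)) \<le> (\<Prod>i\<in>UNIV. exp (- ((1 - y $ i) ^ CARD('k))))"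
    using y by (intro prod_mono conjI) (auto simp: power_le_one intro: order.trans[OF _ exp_ge_add_one_self])
  also have "\<dots> = exp (- (\<Sum>i\<in>UNIV. (1 - y $ i) ^ CARD('k)))"
    by (subst exp_sum[symmetric]) (simp_all add: sum_negf)
  also have "\<dots> \<le> exp (- (real CARD('k option) powi (1 - int CARD('k))))"
    using power_sum_ge[of UNIV "CARD('k option)" "\<lambda>i. 1 - y $ i" "CARD('k)"] assms(2) y
    by simp
  finally show ?thesis
    using order.trans[OF slice_vol_le[OF assms(1)] divide_right_mono] by simp
qed

lemma cube_eq_cbox: "(cube :: (real^'m::finite) set) = cbox 0 1"
  by (auto simp: cube_def mem_box_cart)

lemma integrable_F_power:
  fixes B :: "(real^'k::finite option) set"
  assumes B: "B \<in> sets borel"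
  shows "integrable lborel (\<lambda>y. indicator (cube \<inter> B) y * slice_vol y ^ n)"
proof (rule Bochner_Integration.integrable_bound)
  show "integrable lborel (\<lambda>y :: real^'k option. indicator cube y * (1 / fact CARD('k)) ^ n :: real)"
    unfolding cube_eq_cbox by (intro integrable_mult_left integrable_real_indicator) (use emeasure_lborel_cbox_finite in auto)
  have "slice_vol y \<le> 1 / fact CARD('k)" if "y \<in> cube" for y :: "real^'k option"
  proof -
    have "(\<Prod>i\<in>UNIV. 1 - (1 - y $ i) ^ CARD('k)) \<le> 1"
      using that by (intro prod_le_1) (auto simp: cube_def power_le_one)
    then show ?thesis using order.trans[OF slice_vol_le[OF that] divide_right_mono] by simp
  qed
  then show "AE y in lborel. norm (indicator (cube \<inter> B) y * slice_vol y ^ n)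
      \<le> norm (indicator cube y * (1 / fact CARD('k)) ^ n :: real)"
    by (intro AE_I2) (auto simp: indicator_def slice_vol_nonneg abs_mult power_abs intro!: power_mono)
qed (use slice_vol_power_measurable[OF B] in simp)

definition tail_set :: "(real^'m::finite) set" where
  "tail_set = {y. 1 < (\<Sum>i\<in>UNIV. 1 - y $ i)}"

lemma tail_set_borel: "tail_set \<in> sets borel"
  unfolding tail_set_def by (intro borel_open open_Collect_less continuous_intros)

lemma bounded_fibered: "bounded (fibered B :: ((real^'n::finite^'k::finite) \<times> (real^'k option)) set)"
proof (rule bounded_subset)
  let ?C = "cbox (0, 0) ((\<chi> i j. 1), 1) :: ((real^'n^'k) \<times> (real^'k option)) set"
  show "bounded ?C" by (rule bounded_cbox)
  show "fibered B \<subseteq> ?C"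
  proof
    fix p :: "(real^'n^'k) \<times> (real^'k option)" assume p: "p \<in> fibered B"
    obtain x y where xy: "p = (x, y)" by force
    have y: "0 \<le> y $ i" "y $ i \<le> 1" for i using p by (auto simp: xy fibered_def cube_def)
    have x: "0 \<le> x $ i $ j \<and> x $ i $ j \<le> 1" for i j
    proof -
      have "0 \<le> bary (\<chi> i. x $ i $ j) (Some i) \<and> bary (\<chi> i. x $ i $ j) (Some i) \<le> y $ Some i"
        using p by (auto simp: xy fibered_def slice_def)
      with y[of "Some i"] show ?thesis by (simp add: bary_def)
    qed
    show "p \<in> ?C"
      using x y unfolding xy cbox_Pair_eq by (auto simp: mem_box_cart(2)) (auto simp: mem_box Basis_vec_def inner_axis)
  qed
qed

lemma integer_hull_subset: "integer_hull \<subseteq> P_set \<inter> D_set"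
proof -
  have "convex (P_set :: ('m::finite, 'n::finite) point set)"
    unfolding convex_def P_set_def
    by (auto intro!: add_mono mult_left_mono add_nonneg_nonneg convex_bound_le)
  moreover have "convex (D_set :: ('m::finite, 'n::finite) point set)"
    unfolding convex_def D_set_def by (auto simp: sum.distrib simp flip: sum_distrib_left)
  ultimately show ?thesis
    unfolding integer_hull_def by (intro hull_minimal convex_Int) auto
qed

lemma linear_delete_last_row: "linear delete_last_row"
  by (auto intro!: linearI simp: delete_last_row_def vec_eq_iff)

text \<open>By \<open>mem_integer_hull\<close>, a point of the projected polytope outside the
  projected hull lies above \<open>tail_set\<close>. The image of the hull is measurable because it
  is convex and bounded.\<close>

lemma Vol_difference:
  shows "Vol (integer_hull :: ('k::finite option, 'n::finite) point set) \<le> Vol (P_set \<inter> D_set :: ('k option, 'n) point set)"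
    and "Vol (P_set \<inter> D_set :: ('k option, 'n) point set) - Vol (integer_hull :: ('k option, 'n) point set)
      \<le> measure lebesgue (fibered tail_set :: ((real^'n^'k) \<times> (real^'k option)) set)"
proof -
  let ?G = "fibered UNIV :: ((real^'n^'k) \<times> (real^'k option)) set"
  let ?H = "delete_last_row ` (integer_hull :: ('k option, 'n) point set)"
  have sub: "?H \<subseteq> ?G"
    using integer_hull_subset by (subst P_D_image[symmetric]) (rule image_mono)
  have mH: "?H \<in> lmeasurable"
    by (intro measurable_convex convex_linear_image linear_delete_last_row bounded_subset[OF bounded_fibered sub])
      (simp add: integer_hull_def)
  have mG: "?G \<in> lmeasurable"
    by (intro lmeasurable_compact) (simp add: compact_eq_bounded_closed bounded_fibered closed_fibered_UNIV)
  have "Vol (P_set \<inter> D_set :: ('k option, 'n) point set) = measure lebesgue ?G"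
    by (simp add: Vol_def P_D_image)
  moreover have "measure lebesgue (?G - ?H) = measure lebesgue ?G - measure lebesgue ?H"
    by (rule measurable_measure_Diff[OF mG _ sub]) (use mH in auto)
  moreover have "measure lebesgue (?G - ?H) \<le> measure lebesgue (fibered tail_set :: ((real^'n^'k) \<times> (real^'k option)) set)"
  proof (rule measure_mono_fmeasurable)
    show "?G - ?H \<subseteq> fibered tail_set"
    proof
      fix p assume p: "p \<in> ?G - ?H"
      then obtain x y where xy: "(x, y) \<in> P_set \<inter> D_set" "p = delete_last_row (x, y)"
        by (auto simp flip: P_D_image)
      then have "(x, y) \<notin> integer_hull" using p by blast
      then have "y \<in> tail_set"
        using mem_integer_hull[OF xy(1)] unfolding tail_set_def mem_Collect_eq by (meson not_le)
      then show "p \<in> fibered tail_set"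
        using p xy(2) by (auto simp: fibered_def delete_last_row_def)
    qed
    show "?G - ?H \<in> sets lebesgue" using mG mH by auto
    show "(fibered tail_set :: ((real^'n^'k) \<times> (real^'k option)) set) \<in> lmeasurable"
      by (rule bounded_set_imp_lmeasurable[OF bounded_fibered])
        (rule sets_completionI_sets, simp add: sets_fibered tail_set_borel)
  qed
  ultimately show "Vol (P_set \<inter> D_set :: ('k option, 'n) point set) - Vol (integer_hull :: ('k option, 'n) point set)
      \<le> measure lebesgue (fibered tail_set :: ((real^'n^'k) \<times> (real^'k option)) set)"
    by (simp add: Vol_def)
  show "Vol (integer_hull :: ('k option, 'n) point set) \<le> Vol (P_set \<inter> D_set :: ('k option, 'n) point set)"
    unfolding Vol_def P_D_image
    by (rule measure_mono_fmeasurable[OF sub _ mG]) (use mH in auto)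
qed

lemma measure_fibered_tail_le:
  "measure lebesgue (fibered tail_set :: ((real^'n::finite^'k::finite) \<times> (real^'k option)) set)
     \<le> (exp (- (real CARD('k option) powi (2 - int CARD('k option)))) / fact CARD('k)) ^ CARD('n)"
proof -
  let ?c = "exp (- (real CARD('k option) powi (2 - int CARD('k option)))) / fact CARD('k) :: real"
  have "measure lebesgue (fibered tail_set :: ((real^'n::finite^'k::finite) \<times> (real^'k option)) set)
    = (LINT y|lborel. indicator (cube \<inter> tail_set) y * slice_vol (y :: real^'k option) ^ CARD('n))"
    by (rule measure_fibered[OF tail_set_borel])
  \<comment> \<open>The pointwise bound is constant, and the cube has volume 1.\<close>
  also have "\<dots> \<le> (LINT y|lborel. indicator (cube :: (real^'k option) set) y * ?c ^ CARD('n))"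
  proof (rule integral_mono)
    show "integrable lborel (\<lambda>y. indicator (cube :: (real^'k option) set) y * ?c ^ CARD('n))"
      unfolding cube_eq_cbox by (intro integrable_mult_left integrable_real_indicator) (use emeasure_lborel_cbox_finite in auto)
    fix y :: "real^'k option"
    show "indicator (cube \<inter> tail_set) y * slice_vol y ^ CARD('n) \<le> indicator cube y * ?c ^ CARD('n)"
    proof (cases "y \<in> cube \<inter> tail_set")
      case True
      then have "slice_vol y ^ CARD('n) \<le> ?c ^ CARD('n)"
        by (intro power_mono slice_vol_le_exp slice_vol_nonneg) (auto simp: tail_set_def)
      with True show ?thesis by simp
    qed simp
  qed (rule integrable_F_power[OF tail_set_borel])
  also have "\<dots> = ?c ^ CARD('n)"
    unfolding cube_eq_cbox by (simp add: content_cbox_cart interval_ne_empty_cart)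
  finally show ?thesis .
qed

text \<open>Multiplying by \<open>fact p ^ n\<close> removes the volume of the full simplex. The
  product bound then turns the integrand above \<open>tail_set\<close> into the unnormalised density
  of \<open>mu\<close>. The union bound supplies the hypothesis on \<open>g\<close> in
  \<open>dirichlet_lower\<close>.\<close>

lemma ratio_bounds:
  defines "m \<equiv> CARD('k::finite option)" and "n \<equiv> CARD('n::finite)" and "p \<equiv> CARD('k)"
  shows "measure lebesgue (fibered tail_set :: ((real^'n^'k) \<times> (real^'k option)) set) * fact p ^ n
      \<le> cut_integral p n ^ m * measure (mu m n) {e \<in> space (mu m n). (\<Sum>i=1..m. e i) > 1}"
    and "cut_integral p n ^ m * (1 - 6 / real n)
      \<le> measure lebesgue (fibered UNIV :: ((real^'n^'k) \<times> (real^'k option)) set) * fact p ^ n"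
proof -
  have mp: "m = Suc p" "p \<ge> 1" "m \<ge> 2" "m - 1 = p" "n \<ge> 1"
    by (auto simp: m_def p_def n_def Suc_le_eq)
  obtain b where b: "bij_betw b (UNIV :: 'k option set) {1..m}"
    using finite_same_card_bij[of "UNIV :: 'k option set" "{1..m}"] by (auto simp: m_def)
  let ?N = "PiM {1..m} (\<lambda>_. lborel :: real measure)"
  define v :: "(nat \<Rightarrow> real) \<Rightarrow> real^'k option" where "v f = (\<chi> i. 1 - f (b i))" for f
  have lb: "(lborel :: (real^'k option) measure) = distr ?N borel v"
    unfolding v_def by (rule lborel_vec_reflect[OF b])
  have vm: "v \<in> ?N \<rightarrow>\<^sub>M borel"
    unfolding v_def by (rule measurable_vec_reflect[OF b])
  have bI: "b i \<in> {1..m}" for i using bij_betwE[OF b] by simp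
  have ball: "(\<forall>i. P (b i)) \<longleftrightarrow> (\<forall>k\<in>{1..m}. P k)" for P
    unfolding bij_betw_imp_surj_on[OF b, symmetric] by simp
  have vcube: "v f \<in> cube \<longleftrightarrow> (\<forall>k\<in>{1..m}. f k \<in> {0..1})" for f
    unfolding ball[symmetric] by (auto simp: cube_def v_def)
  have vsum: "(\<Sum>i\<in>UNIV. h (1 - v f $ i)) = (\<Sum>k=1..m. h (f k))" for f and h :: "real \<Rightarrow> real"
    unfolding v_def using sum.reindex_bij_betw[OF b, of "\<lambda>k. h (f k)"] by simp
  have vprod: "(\<Prod>i\<in>UNIV. h (1 - v f $ i)) = (\<Prod>k=1..m. h (f k))" for f and h :: "real \<Rightarrow> real"
    unfolding v_def using prod.reindex_bij_betw[OF b, of "\<lambda>k. h (f k)"] by simp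
  \<comment> \<open>The scaled integrand of \<open>measure_fibered\<close>, pulled back along
    \<open>v\<close> to functions on \<open>{1..m}\<close>.\<close>
  let ?g = "\<lambda>B f. (indicator (cube \<inter> B) (v f) * slice_vol (v f) ^ n) * fact p ^ n"
  have int: "integrable ?N (?g B)" if B: "B \<in> sets borel" for B
  proof -
    have "integrable (distr ?N borel v) (\<lambda>y. indicator (cube \<inter> B) y * slice_vol y ^ n)"
      using integrable_F_power[OF B] by (simp add: lb)
    then show ?thesis
      by (subst (asm) integrable_distr_eq[OF vm slice_vol_power_measurable[OF B]]) simp
  qed
  have val: "measure lebesgue (fibered B :: ((real^'n^'k) \<times> (real^'k option)) set) * fact p ^ n
      = (LINT f|?N. ?g B f)" if B: "B \<in> sets borel" for B
    unfolding measure_fibered[OF B] n_def[symmetric]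
    by (subst lb, subst integral_distr[OF vm slice_vol_power_measurable[OF B]]) simp
  have UNIV_borel: "UNIV \<in> sets (borel :: (real^'k option) measure)" by simp
  show "measure lebesgue (fibered tail_set :: ((real^'n^'k) \<times> (real^'k option)) set) * fact p ^ n
      \<le> cut_integral p n ^ m * measure (mu m n) {e \<in> space (mu m n). (\<Sum>i=1..m. e i) > 1}"
    unfolding val[OF tail_set_borel] mu_tail[OF mp(3), of n, unfolded mp(4)]
  proof (rule integral_mono[OF int[OF tail_set_borel]])
    let ?r = "\<lambda>f. \<Prod>i\<in>{1..m}. cut_pow p n (f i)"
    have ir: "integrable ?N ?r"
      by (intro lborel_power.product_integrable_prod integrable_cut_pow) simp
    have "{f \<in> space ?N. (\<Sum>i=1..m. f i) > 1} \<in> sets ?N"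
      by measurable
    from integrable_mult_indicator[OF this ir]
    have "integrable ?N (\<lambda>f. indicator {f \<in> space ?N. (\<Sum>i=1..m. f i) > 1} f * ?r f)"
      by simp
    then show "integrable ?N (\<lambda>f. indicator {f. (\<Sum>i=1..m. f i) > 1} f * ?r f)"
      by (rule Bochner_Integration.integrable_cong[THEN iffD1, rotated -1]) (auto simp: indicator_def)
    fix f :: "nat \<Rightarrow> real"
    show "?g tail_set f \<le> indicator {f. (\<Sum>i=1..m. f i) > 1} f * ?r f"
    proof (cases "v f \<in> cube \<inter> tail_set")
      case True
      have "slice_vol (v f) * fact p \<le> (\<Prod>k=1..m. 1 - f k ^ p)"
        using slice_vol_le[of "v f"] True vprod[of "\<lambda>t. 1 - t ^ p" f] by (simp add: p_def pos_le_divide_eq)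
      then have "(slice_vol (v f) * fact p) ^ n \<le> (\<Prod>k=1..m. 1 - f k ^ p) ^ n"
        by (intro power_mono) (auto simp: slice_vol_nonneg)
      also have "\<dots> = ?r f"
        using True by (simp add: vcube cut_pow_def prod_power_distrib)
      finally show ?thesis
        using True vsum[of "\<lambda>t. t" f] by (simp add: tail_set_def power_mult_distrib)
    next
      case False
      have "0 \<le> ?r f" by (intro prod_nonneg) (simp add: cut_pow_nonneg)
      with False show ?thesis by (auto simp: indicator_def)
    qed
  qed
  show "cut_integral p n ^ m * (1 - 6 / real n)
      \<le> measure lebesgue (fibered UNIV :: ((real^'n^'k) \<times> (real^'k option)) set) * fact p ^ n"
    unfolding val[OF UNIV_borel] mp(1)
  proof (rule dirichlet_lower[where I = "{1..m}", unfolded mp(1)])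
    show "integrable (PiM {1..Suc p} (\<lambda>_. lborel)) (?g UNIV)" using int[of UNIV] mp(1) by simp
    fix f :: "nat \<Rightarrow> real"
    show "(\<Prod>i\<in>{1..Suc p}. indicator {0..1} (f i)) * (max 0 (1 - (\<Sum>i\<in>{1..Suc p}. f i ^ p))) ^ n \<le> ?g UNIV f"
    proof (cases "v f \<in> cube")
      case True
      have "1 - (\<Sum>k=1..m. f k ^ p) \<le> slice_vol (v f) * fact p"
        using slice_vol_ge[of "v f"] True vsum[of "\<lambda>t. t ^ p" f] by (simp add: p_def pos_divide_le_eq)
      then have "(max 0 (1 - (\<Sum>k=1..m. f k ^ p))) ^ n \<le> (slice_vol (v f) * fact p) ^ n"
        by (intro power_mono) (auto simp: slice_vol_nonneg)
      then show ?thesis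
        using True vcube[of f] mp(1) by (simp add: power_mult_distrib)
    next
      case False
      then obtain a where "a \<in> {1..m}" "f a \<notin> {0..1}" using vcube by auto
      then have zero: "(\<Prod>i\<in>{1..Suc p}. indicator {0..1} (f i) :: real) = 0"
        using mp(1) by (intro prod_zero bexI[of _ a]) auto
      show ?thesis unfolding zero using False by simp
    qed
  qed (use mp in auto)
qed

section \<open>Combining the estimates above the tail with the lower bound for the whole
  polytope\<close>

theorem proposition17:
  fixes m n :: nat
    and P D H :: "('k::finite option, 'n::finite) point set"
  assumes m: "m = CARD('k option)" "m \<ge> 2"
    and n: "n = CARD('n)" "n \<ge> 1"
    and P: "P = P_set" and D: "D = D_set" and H: "H = integer_hull"
  shows "0 \<le> Vol (P \<inter> D) - Vol H
       \<and> Vol (P \<inter> D) - Vol H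
           \<le> fact (m - 1) powi (- int n) * exp (- (real n * real m powi (2 - int m)))
       \<and> (n > 11 \<longrightarrow>
           1 - Vol H / Vol (P \<inter> D)
             \<le> measure (mu m n) {e \<in> space (mu m n). (\<Sum>i=1..m. e i) > 1}
                 / (1 - 12 / (real n + 1)))"
proof (intro conjI impI)
  let ?p = "CARD('k)"
  let ?T = "measure lebesgue (fibered tail_set :: ((real^'n^'k) \<times> (real^'k option)) set)"
  have p: "m - 1 = ?p" "?p \<ge> 1" using m by (auto simp: Suc_le_eq)
  show "0 \<le> Vol (P \<inter> D) - Vol H"
    using Vol_difference(1)[where 'k='k and 'n='n] by (simp add: P D H)
  have diff: "Vol (P \<inter> D) - Vol H \<le> ?T"
    unfolding P D H by (rule Vol_difference(2))
  also have "\<dots> \<le> (exp (- (real m powi (2 - int m))) / fact (m - 1)) ^ n"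
    using measure_fibered_tail_le[where 'k='k and 'n='n] unfolding m(1)[symmetric] n(1)[symmetric] p(1) .
  also have "\<dots> = fact (m - 1) powi (- int n) * exp (- (real n * real m powi (2 - int m)))"
    by (simp add: power_divide power_int_minus field_simps flip: exp_of_nat_mult)
  finally show "Vol (P \<inter> D) - Vol H \<le> fact (m - 1) powi (- int n) * exp (- (real n * real m powi (2 - int m)))" .
  assume n11: "n > 11"
  define \<mu> where "\<mu> = measure (mu m n) {e \<in> space (mu m n). (\<Sum>i=1..m. e i) > 1}"
  define t where "t = 1 - 12 / (real n + 1)"
  define a where "a = (fact ?p ^ n :: real)"
  define Z where "Z = cut_integral ?p n ^ m"
  \<comment> \<open>The condition \<open>n > 11\<close> is what makes \<open>t\<close> positive, so
    that it may later be divided by.\<close>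
  have pos: "0 < t" "0 < a" "0 < Z" "0 \<le> \<mu>"
    using n11 cut_integral_pos[OF p(2)] by (auto simp: t_def a_def Z_def \<mu>_def field_simps)
  have "(Vol (P \<inter> D) - Vol H) * a \<le> ?T * a"
    using diff pos by (intro mult_right_mono) auto
  also have "\<dots> \<le> Z * \<mu>"
    using ratio_bounds(1)[where 'k='k and 'n='n] by (simp add: a_def Z_def \<mu>_def m n)
  finally have up: "(Vol (P \<inter> D) - Vol H) * a \<le> Z * \<mu>" .
  \<comment> \<open>For \<open>n \<ge> 1\<close> one has \<open>6 / n \<le> 12 / (n + 1)\<close>, so
    the denominator in the claim is the weaker one.\<close>
  have "t \<le> 1 - 6 / real n" using n11 by (simp add: t_def field_simps)
  then have "Z * t \<le> Z * (1 - 6 / real n)" using pos by (intro mult_left_mono) auto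
  also have "\<dots> \<le> Vol (P \<inter> D) * a"
    using ratio_bounds(2)[where 'k='k and 'n='n] by (simp add: a_def Z_def m n P D Vol_def P_D_image)
  finally have low: "Z * t \<le> Vol (P \<inter> D) * a" .
  have "0 < Vol (P \<inter> D) * a" using low pos by (intro less_le_trans[OF _ low]) auto
  then have V: "0 < Vol (P \<inter> D)" using pos by (simp add: zero_less_mult_iff)
  \<comment> \<open>Multiplying \<open>up\<close> by \<open>t\<close> and \<open>low\<close> by the
    tail probability makes \<open>Z\<close> drop out between them; the common factor
    \<open>a\<close> is cancelled afterwards.\<close>
  have "((Vol (P \<inter> D) - Vol H) * t) * a = ((Vol (P \<inter> D) - Vol H) * a) * t" by simp
  also have "\<dots> \<le> (Z * \<mu>) * t" using up pos by (intro mult_right_mono) auto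
  also have "\<dots> = \<mu> * (Z * t)" by simp
  also have "\<dots> \<le> \<mu> * (Vol (P \<inter> D) * a)" using low pos by (intro mult_left_mono) auto
  finally have "(Vol (P \<inter> D) - Vol H) * t \<le> \<mu> * Vol (P \<inter> D)"
    using pos by (simp add: mult.assoc[symmetric])
  then have "1 - Vol H / Vol (P \<inter> D) \<le> \<mu> / t"
    using V pos by (simp add: field_simps)
  then show "1 - Vol H / Vol (P \<inter> D) \<le> measure (mu m n) {e \<in> space (mu m n). (\<Sum>i=1..m. e i) > 1}
                 / (1 - 12 / (real n + 1))"
    by (simp add: \<mu>_def t_def)
qed

end
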